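(* For every sufficiently small absolute constant $\lambda>1$, there is an efficient $\epsilon$-differentially private algorithm for Uniform Facility Location on $\lambda$-HST metrics, under the super-set output setting, whose expected multiplicative approximation ratio is $O(1/\epsilon)$.
   Context: Uniform Facility Location (UFL): an instance is a tuple $(V,d,f,\vec N)$, where $(V,d)$ is an $n$-point metric, $f\ge 0$ is the facility cost, and $\vec N=(N_v)_{v\in V}\in\mathbb{Z}_{\ge0}^V$ gives the number of clients at each location. The cost of $S\subseteq V$ is $\mathrm{cost}_d(S;\vec N)=|S|\cdot f+\sum_{v\in V}N_v\, d(v,S)$, where $d(v,S)=\min_{s\in S}d(v,s)$; the goal is to minimize it. Super-set output setting: the algorithm outputs a set $R$ of potential facility locations; every client is connected to its nearest location in $R$, and the set $S\subseteq R$ of actually opened facilities is the set of locations in $R$ with at least one connected client. The cost of the solution is the cost of $S$. Differential privacy: a randomized algorithm $\mathcal{A}$ taking $\vec N$ as input is $\epsilon$-DP if for all $\vec N,\vec N'$ with $\|\vec N-\vec N'\|_1=1$ and every event $\mathcal{T}$ in the output space, $\Pr[\mathcal{A}(\vec N)\in\mathcal{T}]\le e^{\epsilon}\Pr[\mathcal{A}(\vec N')\in\mathcal{T}]$. The (expected multiplicative) approximation ratio is the expected cost of the algorithm's solution divided by the optimum cost, maximized over instances. $\lambda$-HST: for real $\lambda>1$ and integer $L\ge1$, a $\lambda$-hierarchically well-separated tree of depth $L$ is an edge-weighted rooted tree in which every root-to-leaf path has exactly $L$ edges and, defining the level of a vertex $v$ as $L$ minus the number of edges on the root-to-$v$ path,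 every edge between vertices of levels $\ell$ and $\ell+1$ has weight $\lambda^\ell$. A metric $(V,d)$ is a $\lambda$-HST metric if there is a $\lambda$-HST $T$ with leaf set $V$ such that $d$ is the shortest-path distance of $T$ restricted to $V$; the tree $T$ is given along with the metric. *)

theory Defs
  imports "HOL-Probability.Probability" "HOL-Computational_Algebra.Polynomial"
begin

section \<open>Uniform facility location\<close>

text \<open>
  Costs are extended nonnegative reals, so that the distance to the empty set is \<open>\<infinity>\<close>, and
  \<open>0 * \<infinity> = 0\<close>: the empty set is a solution (of cost 0) exactly when there are no clients.
\<close>

definition ufl_instance :: "'v set \<Rightarrow> ('v \<Rightarrow> 'v \<Rightarrow> real) \<Rightarrow> real \<Rightarrow> bool" where
  "ufl_instance V d f \<longleftrightarrow> finite V \<and> V \<noteq> {} \<and> Metric_space V d \<and> 0 \<le> f"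

definition set_dist :: "('v \<Rightarrow> 'v \<Rightarrow> real) \<Rightarrow> 'v \<Rightarrow> 'v set \<Rightarrow> ennreal" where
  "set_dist d v S = (INF s\<in>S. ennreal (d v s))"

definition ufl_cost ::
    "'v set \<Rightarrow> ('v \<Rightarrow> 'v \<Rightarrow> real) \<Rightarrow> real \<Rightarrow> ('v \<Rightarrow> nat) \<Rightarrow> 'v set \<Rightarrow> ennreal" where
  "ufl_cost V d f N S = of_nat (card S) * ennreal f + (\<Sum>v\<in>V. of_nat (N v) * set_dist d v S)"

definition ufl_opt ::
    "'v set \<Rightarrow> ('v \<Rightarrow> 'v \<Rightarrow> real) \<Rightarrow> real \<Rightarrow> ('v \<Rightarrow> nat) \<Rightarrow> ennreal" where
  "ufl_opt V d f N = (INF S\<in>Pow V. ufl_cost V d f N S)"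


subsection \<open>Super-set output setting\<close>

definition nearest :: "('v \<Rightarrow> 'v \<Rightarrow> real) \<Rightarrow> 'v set \<Rightarrow> 'v \<Rightarrow> 'v set" where
  "nearest d R v = {r \<in> R. \<forall>s\<in>R. d v r \<le> d v s}"

definition nearest_connection ::
    "'v set \<Rightarrow> ('v \<Rightarrow> 'v \<Rightarrow> real) \<Rightarrow> ('v \<Rightarrow> nat) \<Rightarrow> 'v set \<Rightarrow> ('v \<Rightarrow> 'v) \<Rightarrow> bool" where
  "nearest_connection V d N R g \<longleftrightarrow> (\<forall>v\<in>V. 0 < N v \<longrightarrow> g v \<in> nearest d R v)"

definition opened :: "'v set \<Rightarrow> ('v \<Rightarrow> nat) \<Rightarrow> ('v \<Rightarrow> 'v) \<Rightarrow> 'v set" where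
  "opened V N g = g ` {v \<in> V. 0 < N v}"

text \<open>
  Distances in a tree metric have many ties.  The clients break them so that the cost of the set
  of opened facilities is least.  A rule that selects a nearest element of \<open>R\<close> without looking at
  the clients would not do: below a chain of heavy ancestors of one crowded leaf, a private \<open>R\<close>
  cannot tell which of very many siblings is the crowded one, so such a rule opens a new facility
  for a light client on every level.  If there are clients and \<open>R\<close> is empty, the cost is \<open>\<infinity>\<close>.
\<close>

definition superset_cost ::
    "'v set \<Rightarrow> ('v \<Rightarrow> 'v \<Rightarrow> real) \<Rightarrow> real \<Rightarrow> ('v \<Rightarrow> nat) \<Rightarrow> 'v set \<Rightarrow> ennreal" where
  "superset_cost V d f N R =
     (INF g\<in>{g. nearest_connection V d N R g}. ufl_cost V d f N (opened V N g))"


section \<open>Differential privacy\<close>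

definition differentially_private ::
    "real \<Rightarrow> 'v set \<Rightarrow> (('v \<Rightarrow> nat) \<Rightarrow> 'o pmf) \<Rightarrow> bool" where
  "differentially_private \<epsilon> V A \<longleftrightarrow>
     (\<forall>N N'. (\<Sum>v\<in>V. \<bar>int (N v) - int (N' v)\<bar>) = 1 \<longrightarrow>
        (\<forall>E. measure_pmf.prob (A N) E \<le> exp \<epsilon> * measure_pmf.prob (A N') E))"


section \<open>Hierarchically well-separated trees\<close>

text \<open>
  Trees are given to algorithms as parent arrays: the vertices are \<open>0, \<dots>, vnum T - 1\<close>, numbered
  in any order, and the value of \<open>parent T\<close> at the root is irrelevant.
\<close>

record rtree =
  vnum :: nat
  root_vertex :: nat
  parent :: "nat \<Rightarrow> nat"
  height :: nat

definition rooted_tree :: "rtree \<Rightarrow> bool" where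
  "rooted_tree T \<longleftrightarrow> root_vertex T < vnum T \<and>
     (\<forall>v<vnum T. v \<noteq> root_vertex T \<longrightarrow> parent T v < vnum T) \<and>
     (\<forall>v<vnum T. \<exists>k. (parent T ^^ k) v = root_vertex T)"

definition leaves :: "rtree \<Rightarrow> nat set" where
  "leaves T = {v. v < vnum T \<and> (\<forall>u<vnum T. u \<noteq> root_vertex T \<longrightarrow> parent T u \<noteq> v)}"

definition depth :: "rtree \<Rightarrow> nat \<Rightarrow> nat" where
  "depth T v = (LEAST k. (parent T ^^ k) v = root_vertex T)"

definition level :: "rtree \<Rightarrow> nat \<Rightarrow> nat" where
  "level T v = height T - depth T v"

definition hst_tree :: "rtree \<Rightarrow> bool" where
  "hst_tree T \<longleftrightarrow> rooted_tree T \<and> 1 \<le> height T \<and> (\<forall>v\<in>leaves T. depth T v = height T)"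

definition tree_adj :: "rtree \<Rightarrow> nat \<Rightarrow> nat \<Rightarrow> bool" where
  "tree_adj T u v \<longleftrightarrow> u < vnum T \<and> v < vnum T \<and>
     (u \<noteq> root_vertex T \<and> parent T u = v \<or> v \<noteq> root_vertex T \<and> parent T v = u)"

text \<open>The lower end of an edge between levels \<open>l\<close> and \<open>l + 1\<close> is the one of smaller level.\<close>

definition edge_weight :: "real \<Rightarrow> rtree \<Rightarrow> nat \<Rightarrow> nat \<Rightarrow> real" where
  "edge_weight lam T u v = lam ^ min (level T u) (level T v)"

definition tree_walk :: "rtree \<Rightarrow> nat \<Rightarrow> nat list \<Rightarrow> nat \<Rightarrow> bool" where
  "tree_walk T u p v \<longleftrightarrow> p \<noteq> [] \<and> hd p = u \<and> last p = v \<and> set p \<subseteq> {..<vnum T} \<and>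
     successively (tree_adj T) p"

definition walk_weight :: "real \<Rightarrow> rtree \<Rightarrow> nat list \<Rightarrow> real" where
  "walk_weight lam T p = sum_list (map2 (edge_weight lam T) (butlast p) (tl p))"

definition tree_dist :: "real \<Rightarrow> rtree \<Rightarrow> nat \<Rightarrow> nat \<Rightarrow> real" where
  "tree_dist lam T u v = Inf {walk_weight lam T p |p. tree_walk T u p v}"

definition hst_metric :: "real \<Rightarrow> rtree \<Rightarrow> nat set \<Rightarrow> (nat \<Rightarrow> nat \<Rightarrow> real) \<Rightarrow> bool" where
  "hst_metric lam T V d \<longleftrightarrow> hst_tree T \<and> V = leaves T \<and>
     (\<forall>u\<in>V. \<forall>v\<in>V. d u v = tree_dist lam T u v)"

definition hst_instance ::
    "real \<Rightarrow> rtree \<Rightarrow> nat set \<Rightarrow> (nat \<Rightarrow> nat \<Rightarrow> real) \<Rightarrow> real \<Rightarrow> bool" where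
  "hst_instance lam T V d f \<longleftrightarrow> ufl_instance V d f \<and> hst_metric lam T V d"

text \<open>
  In \<open>ennreal\<close>, \<open>0 / 0 = 0\<close> and \<open>x / 0 = \<infinity>\<close> for \<open>x > 0\<close>: on an instance of optimum 0 the expected
  cost has to be 0 for the ratio to be finite.
\<close>

definition approx_ratio ::
    "real \<Rightarrow> (rtree \<Rightarrow> real \<Rightarrow> (nat \<Rightarrow> nat) \<Rightarrow> nat set pmf) \<Rightarrow> ennreal" where
  "approx_ratio lam A =
     (SUP (T, V, d, f, N) \<in> {(T, V, d, f, N). hst_instance lam T V d f}.
        (\<integral>\<^sup>+ R. superset_cost V d f N R \<partial>measure_pmf (A T f N)) / ufl_opt V d f N)"


section \<open>A randomized real RAM\<close>

text \<open>
  Programs work on arrays of natural numbers and arrays of real numbers (array name, then index).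
  Every elementary operation takes unit time.  On naturals there is no multiplication, and reals
  cannot be rounded to naturals; the only constants in a program are natural numbers, so a program
  is a finite object that carries no real-valued advice.  Randomness comes from independent coins
  whose bias is a computed real number, i.e. from comparing a uniform random real with it.
\<close>

record memory =
  nats :: "nat \<Rightarrow> nat \<Rightarrow> nat"
  reals :: "nat \<Rightarrow> nat \<Rightarrow> real"

datatype nexp =
    NConst nat
  | NLoad nat nexp
  | NAdd nexp nexp
  | NSub nexp nexp

datatype rexp =
    ROfNat nexp
  | RLoad nat nexp
  | RAdd rexp rexp
  | RSub rexp rexp
  | RMul rexp rexp
  | RDiv rexp rexp
  | RExp rexp
  | RLn rexp

datatype test =
    NLess nexp nexp
  | RLess rexp rexp

datatype com =
    NStore nat nexp nexp
  | RStore nat nexp rexp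
  | Flip nat nexp rexp
  | Seq com com
  | Cond test com com
  | For nat nexp com

primrec nval :: "nexp \<Rightarrow> memory \<Rightarrow> nat" where
  "nval (NConst k) s = k"
| "nval (NLoad a e) s = nats s a (nval e s)"
| "nval (NAdd e e') s = nval e s + nval e' s"
| "nval (NSub e e') s = nval e s - nval e' s"

primrec rval :: "rexp \<Rightarrow> memory \<Rightarrow> real" where
  "rval (ROfNat e) s = real (nval e s)"
| "rval (RLoad a e) s = reals s a (nval e s)"
| "rval (RAdd e e') s = rval e s + rval e' s"
| "rval (RSub e e') s = rval e s - rval e' s"
| "rval (RMul e e') s = rval e s * rval e' s"
| "rval (RDiv e e') s = rval e s / rval e' s"
| "rval (RExp e) s = exp (rval e s)"
| "rval (RLn e) s = ln (rval e s)"

primrec tval :: "test \<Rightarrow> memory \<Rightarrow> bool" where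
  "tval (NLess e e') s \<longleftrightarrow> nval e s < nval e' s"
| "tval (RLess e e') s \<longleftrightarrow> rval e s < rval e' s"

definition nstore :: "nat \<Rightarrow> nat \<Rightarrow> nat \<Rightarrow> memory \<Rightarrow> memory" where
  "nstore a i k s = s\<lparr>nats := (nats s)(a := (nats s a)(i := k))\<rparr>"

definition rstore :: "nat \<Rightarrow> nat \<Rightarrow> real \<Rightarrow> memory \<Rightarrow> memory" where
  "rstore a i x s = s\<lparr>reals := (reals s)(a := (reals s a)(i := x))\<rparr>"

primrec iterate ::
    "(nat \<Rightarrow> memory \<Rightarrow> (memory \<times> nat) pmf) \<Rightarrow> nat \<Rightarrow> memory \<Rightarrow> (memory \<times> nat) pmf" where
  "iterate b 0 s = return_pmf (s, 1)"
| "iterate b (Suc k) s =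
     bind_pmf (iterate b k s) (\<lambda>(s1, t1).
       map_pmf (\<lambda>(s2, t2). (s2, t1 + t2 + 1)) (b k s1))"

text \<open>
  \<open>run c s\<close> is the joint distribution of the final memory and the running time.  The expressions
  in a program have a fixed size, so counting one unit for evaluating an expression changes the
  running time by at most a constant factor depending on the program.  \<open>For x e c\<close> runs \<open>c\<close> with
  cell 0 of array \<open>x\<close> set to \<open>0, \<dots>, k - 1\<close> in turn, where \<open>k\<close> is the value of \<open>e\<close> on entry.
  \<open>bernoulli_pmf\<close> clips the bias to the unit interval.
\<close>

primrec run :: "com \<Rightarrow> memory \<Rightarrow> (memory \<times> nat) pmf" where
  "run (NStore a i e) s = return_pmf (nstore a (nval i s) (nval e s) s, 1)"
| "run (RStore a i e) s = return_pmf (rstore a (nval i s) (rval e s) s, 1)"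
| "run (Flip a i e) s =
     map_pmf (\<lambda>b. (nstore a (nval i s) (of_bool b) s, 1)) (bernoulli_pmf (rval e s))"
| "run (Seq c c') s =
     bind_pmf (run c s) (\<lambda>(s1, t1). map_pmf (\<lambda>(s2, t2). (s2, t1 + t2)) (run c' s1))"
| "run (Cond b c c') s =
     map_pmf (\<lambda>(s1, t1). (s1, t1 + 1)) (if tval b s then run c s else run c' s)"
| "run (For x e c) s = iterate (\<lambda>i s1. run c (nstore x 0 i s1)) (nval e s) s"


subsection \<open>Programs for facility location on trees\<close>

definition input_memory ::
    "real \<Rightarrow> real \<Rightarrow> rtree \<Rightarrow> real \<Rightarrow> (nat \<Rightarrow> nat) \<Rightarrow> memory" where
  "input_memory lam \<epsilon> T f N =
     \<lparr>nats = (\<lambda>a i.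
        if a = 0 then (if i = 0 then vnum T else if i = 1 then root_vertex T
                       else if i = 2 then height T else 0)
        else if a = 1 then (if i < vnum T then if i = root_vertex T then i else parent T i else 0)
        else if a = 2 then of_bool (i \<in> leaves T)
        else if a = 3 then (if i \<in> leaves T then N i else 0)
        else 0),
      reals = (\<lambda>a i.
        if a = 0 then (if i = 0 then lam else if i = 1 then f else if i = 2 then \<epsilon> else 0)
        else 0)\<rparr>"

definition output_set :: "rtree \<Rightarrow> memory \<Rightarrow> nat set" where
  "output_set T s = {v \<in> leaves T. nats s 4 v \<noteq> 0}"

definition ufl_algorithm ::
    "com \<Rightarrow> real \<Rightarrow> real \<Rightarrow> rtree \<Rightarrow> real \<Rightarrow> (nat \<Rightarrow> nat) \<Rightarrow> nat set pmf" where
  "ufl_algorithm c lam \<epsilon> T f N =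
     map_pmf (\<lambda>(s, t). output_set T s) (run c (input_memory lam \<epsilon> T f N))"

text \<open>
  Worst-case polynomial time in the number of vertices of the given tree, uniformly in the numbers
  \<open>\<epsilon>\<close>, \<open>f\<close> and \<open>N\<close> and over all outcomes of the coins.
\<close>

definition efficient :: "com \<Rightarrow> real \<Rightarrow> bool" where
  "efficient c lam \<longleftrightarrow>
     (\<exists>p :: nat poly. \<forall>\<epsilon>>0. \<forall>T V d f N. hst_instance lam T V d f \<longrightarrow>
        (\<forall>(s, t) \<in> set_pmf (run c (input_memory lam \<epsilon> T f N)). t \<le> poly p (vnum T)))"

end

theory Submission
  imports Defs
begin

text \<open>
  Vertices of level \<open>k\<close> with \<open>f \<le> lam ^ k\<close> are always marked.  A vertex with \<open>x = lam ^ k / f < 1\<close>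
  and \<open>c\<close> clients below it is marked with probability \<open>\<sigma> ((\<epsilon> * \<surd>x * c - 1 / \<surd>x) / M)\<close> for the
  logistic function \<open>\<sigma>\<close>.  The logarithms of \<open>\<sigma>\<close> and \<open>1 - \<sigma>\<close> are 1-Lipschitz and the numbers \<open>\<surd>x\<close>
  along a root path are bounded by a geometric series of sum at most \<open>M\<close>, whence the privacy.

  The marked vertices all of whose ancestors are marked form a subtree containing the root; the
  output consists of one leaf below each minimal vertex of this subtree.  Every client may connect
  to any output leaf below its lowest ancestor in the subtree, at a cost proportional to the weight
  of the edge above its topmost unmarked ancestor.  The optimum is at least the sum over any
  antichain of \<open>min f (c * lam ^ k)\<close>; it pays for the connections of vertices whose \<open>c * lam ^ k\<close> is
  \<open>O(f / \<epsilon>)\<close>, and for a facility at each minimal vertex among those with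
  \<open>c * lam ^ k \<ge> f / (2 * \<epsilon>)\<close>.  Wrong decisions at the other vertices are so improbable that they cost
  \<open>O(\<surd>x / \<epsilon>)\<close> times the optimum in expectation per level, again a geometric series.
\<close>

section \<open>Distances between leaves\<close>

text \<open>The square root balances two demands. Privacy limits the slopes of the exponents along a
  root path to a sum of O(\<epsilon>), so they must decay with x. Accuracy asks for steep exponents:
  a wrong mark may cost a facility f where the optimum is only known to pay lam ^ k = x * f, so it
  must be rarer than x, and a further factor \<surd>x is spent on the sum over levels, since
  benefits are bounded by the optimum within one level but not across levels. With slope \<epsilon>
  * \<surd>x the coin is fair at c * lam ^ k = f / \<epsilon>, and below half of that its exponent
  is at most - 1 / (2 * M * \<surd>x), which makes the probability smaller than any power of x up to
  a constant.

  Vertices without clients may be marked in large numbers, and nothing in the optimum pays for them.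
  The super-set setting is what makes this harmless: no client means no opened facility, so only
  wrong marks above at least one client are charged.\<close>

definition par :: "rtree \<Rightarrow> nat \<Rightarrow> nat" where
  "par T v = (if v = root_vertex T then v else parent T v)"

text \<open>Unlike \<open>parent T\<close>, whose value at the root is arbitrary,
  \<open>par T\<close> fixes the root. Iterating past the root is therefore harmless, here and in
  the program, whose parent array follows the same convention.\<close>

definition anc :: "rtree \<Rightarrow> nat \<Rightarrow> nat \<Rightarrow> nat" where
  "anc T k v = (par T ^^ k) v"

text \<open>The weight of the path from a leaf to its \<open>k\<close>-th ancestor.\<close>

definition hsum :: "real \<Rightarrow> nat \<Rightarrow> real" where
  "hsum lam k = (\<Sum>j<k. lam ^ j)"

lemma anc_0 [simp]: "anc T 0 v = v"
  by (simp add: anc_def)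

lemma anc_Suc: "anc T (Suc k) v = par T (anc T k v)"
  by (simp add: anc_def)

lemma anc_add: "anc T (i + j) v = anc T i (anc T j v)"
  by (simp add: anc_def funpow_add)

lemma anc_mono_eq:
  assumes "anc T k u = anc T k v" "k \<le> j" shows "anc T j u = anc T j v"
  using assms anc_add[of T "j - k" k] by simp

lemma walk_weight_Cons:
  "walk_weight lam T (x # y # p) = edge_weight lam T x y + walk_weight lam T (y # p)"
  by (simp add: walk_weight_def)

lemma tree_walk_single: "u < vnum T \<Longrightarrow> tree_walk T u [u] u"
  by (simp add: tree_walk_def)

lemma tree_walk_Cons:
  assumes "tree_walk T v p w" "tree_adj T u v"
  shows "tree_walk T u (u # p) w"
  using assms by (cases p) (auto simp: tree_walk_def tree_adj_def)

lemma walk_weight_tree_walk_Cons: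
  assumes "tree_walk T v p w"
  shows "walk_weight lam T (u # p) = edge_weight lam T u v + walk_weight lam T p"
  using assms by (cases p) (auto simp: tree_walk_def walk_weight_Cons)

lemma tree_adj_sym: "tree_adj T u v \<Longrightarrow> tree_adj T v u"
  by (auto simp: tree_adj_def)

lemma edge_weight_sym: "edge_weight lam T u v = edge_weight lam T v u"
  by (simp add: edge_weight_def min.commute)

section \<open>Ancestors and levels in a well-separated tree\<close>

locale hst =
  fixes T :: rtree and lam :: real
  assumes hst: "hst_tree T" and lam: "1 < lam"
begin

abbreviation "n \<equiv> vnum T"
abbreviation "rt \<equiv> root_vertex T"
abbreviation "L \<equiv> height T"

lemma rooted: "rooted_tree T" and L_pos: "1 \<le> L"
  and depth_leaf: "v \<in> leaves T \<Longrightarrow> depth T v = L"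
  using hst by (auto simp: hst_tree_def)

lemma leaf_lt: "v \<in> leaves T \<Longrightarrow> v < n"
  by (simp add: leaves_def)

lemma finite_leaves: "finite (leaves T)"
  by (rule finite_subset[of _ "{..<n}"]) (auto simp: leaves_def)

lemma par_lt: "v < n \<Longrightarrow> par T v < n"
  using rooted by (auto simp: rooted_tree_def par_def)

lemma anc_lt: "v < n \<Longrightarrow> anc T k v < n"
  by (induction k) (auto simp: anc_Suc par_lt)

lemma depth_root [simp]: "depth T rt = 0"
  by (simp add: depth_def)

lemma depth_Suc:
  assumes "v < n" "v \<noteq> rt" shows "depth T v = Suc (depth T (parent T v))"
proof -
  obtain k where k: "(parent T ^^ k) v = rt"
    using rooted assms by (auto simp: rooted_tree_def)
  have "depth T v = Suc (LEAST m. (parent T ^^ Suc m) v = rt)"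
    unfolding depth_def by (rule Least_Suc[where P = "\<lambda>k. (parent T ^^ k) v = rt", OF k]) (use assms in auto)
  then show ?thesis
    by (simp only: depth_def funpow_Suc_right o_apply)
qed

lemma depth_eq_0: "v < n \<Longrightarrow> depth T v = 0 \<Longrightarrow> v = rt"
  using depth_Suc by fastforce

lemma depth_par: "v < n \<Longrightarrow> depth T (par T v) = depth T v - 1"
  by (auto simp: par_def depth_Suc)

lemma depth_anc: "v < n \<Longrightarrow> depth T (anc T k v) = depth T v - k"
  by (induction k) (auto simp: anc_Suc depth_par anc_lt)

lemma level_anc: "u \<in> leaves T \<Longrightarrow> k \<le> L \<Longrightarrow> level T (anc T k u) = k"
  by (simp add: level_def depth_anc leaf_lt depth_leaf)

lemma anc_L: "u \<in> leaves T \<Longrightarrow> anc T L u = rt"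
  by (rule depth_eq_0) (auto simp: anc_lt leaf_lt depth_anc depth_leaf)

lemma anc_rt [simp]: "anc T k rt = rt"
  by (induction k) (auto simp: anc_Suc par_def)

lemma anc_ge_L: "u \<in> leaves T \<Longrightarrow> L \<le> k \<Longrightarrow> anc T k u = rt"
  using anc_add[of T "k - L" L u] by (simp add: anc_L)

lemma anc_eq_level:
  "u \<in> leaves T \<Longrightarrow> v \<in> leaves T \<Longrightarrow> j \<le> L \<Longrightarrow> k \<le> L \<Longrightarrow> anc T j u = anc T k v \<Longrightarrow> j = k"
  using level_anc by metis

text \<open>The ancestors of a leaf on levels 0 to \<open>L\<close> are distinct. This bounds the
  loops along a root path, of at most \<open>L + 1\<close> rounds, by the number of
  vertices.\<close>

lemma height_lt:
  assumes "u \<in> leaves T" shows "L < n"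
proof -
  have "inj_on (\<lambda>k. anc T k u) {..L}"
    using anc_eq_level[OF assms assms] by (auto simp: inj_on_def)
  moreover have "(\<lambda>k. anc T k u) ` {..L} \<subseteq> {..<n}"
    using anc_lt leaf_lt assms by auto
  ultimately have "card {..L} \<le> card {..<n}"
    by (rule card_inj_on_le) simp
  then show ?thesis by simp
qed

section \<open>Tree distances via explicit walks and potentials\<close>

lemma adj_anc:
  assumes "u \<in> leaves T" "j < L" shows "tree_adj T (anc T j u) (anc T (Suc j) u)"
proof -
  have "anc T j u \<noteq> rt"
    using depth_anc[of u j] assms by (auto simp: leaf_lt depth_leaf)
  then show ?thesis
    using assms anc_lt[of u] leaf_lt[of u] by (auto simp: tree_adj_def anc_Suc par_def)
      (metis anc_Suc par_def)
qed

lemma edge_anc: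
  assumes "u \<in> leaves T" "j < L"
  shows "edge_weight lam T (anc T j u) (anc T (Suc j) u) = lam ^ j"
  using assms by (simp add: edge_weight_def level_anc)

lemma walk_up:
  assumes "u \<in> leaves T" "k \<le> L" "tree_walk T (anc T k u) p w"
  shows "\<exists>q. tree_walk T u q w \<and> walk_weight lam T q = hsum lam k + walk_weight lam T p"
  using assms(2,3)
proof (induction k arbitrary: p)
  case 0
  then show ?case by (auto simp: hsum_def)
next
  case (Suc k)
  let ?p = "anc T k u # p"
  have "tree_walk T (anc T k u) ?p w"
    by (rule tree_walk_Cons[OF Suc.prems(2)]) (use adj_anc assms Suc.prems in auto)
  moreover have "walk_weight lam T ?p = lam ^ k + walk_weight lam T p"
    using walk_weight_tree_walk_Cons[OF Suc.prems(2)] edge_anc assms Suc.prems by simp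
  ultimately show ?case
    using Suc.IH[of ?p] Suc.prems(1) by (auto simp: hsum_def)
qed

lemma walk_down:
  assumes "u \<in> leaves T" "k \<le> L"
  shows "\<exists>q. tree_walk T (anc T k u) q u \<and> walk_weight lam T q = hsum lam k"
  using assms(2)
proof (induction k)
  case 0
  then show ?case
    using tree_walk_single[of u T] leaf_lt[OF assms(1)]
    by (intro exI[of _ "[u]"]) (auto simp: hsum_def walk_weight_def)
next
  case (Suc k)
  then obtain q where q: "tree_walk T (anc T k u) q u" "walk_weight lam T q = hsum lam k" by auto
  let ?q = "anc T (Suc k) u # q"
  have "tree_walk T (anc T (Suc k) u) ?q u"
    by (rule tree_walk_Cons[OF q(1)]) (use adj_anc assms Suc.prems tree_adj_sym in auto)
  moreover have "walk_weight lam T ?q = lam ^ k + walk_weight lam T q"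
    using walk_weight_tree_walk_Cons[OF q(1)] edge_anc[OF assms(1)] Suc.prems
    by (simp add: edge_weight_sym)
  ultimately show ?case using q(2) by (intro exI[of _ ?q]) (auto simp: hsum_def)
qed

lemma ex_walk:
  assumes u: "u \<in> leaves T" and v: "v \<in> leaves T"
  shows "\<exists>p. tree_walk T u p v"
  using walk_up[OF u, of L] walk_down[OF v, of L] anc_L[OF u] anc_L[OF v] by (metis order_refl)

lemma edge_weight_nonneg: "0 \<le> edge_weight lam T x y"
  using lam by (simp add: edge_weight_def)

lemma walk_weight_nonneg: "0 \<le> walk_weight lam T p"
  by (auto simp: walk_weight_def edge_weight_nonneg intro!: sum_list_nonneg)

lemma tree_dist_upper:
  assumes "u \<in> leaves T" "v \<in> leaves T" "k \<le> L" "anc T k u = anc T k v"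
  shows "tree_dist lam T u v \<le> 2 * hsum lam k"
proof -
  obtain p where "tree_walk T (anc T k u) p v" "walk_weight lam T p = hsum lam k"
    using walk_down[OF assms(2,3)] assms(4) by auto
  then obtain q where "tree_walk T u q v" "walk_weight lam T q = 2 * hsum lam k"
    using walk_up[OF assms(1,3)] by fastforce
  then show ?thesis
    unfolding tree_dist_def
    by (intro cInf_lower) (auto intro!: bdd_belowI[of _ 0] simp: walk_weight_nonneg, metis)
qed

text \<open>Potentials avoid any analysis of the shape of a walk: a function that grows along each
  edge by at most its weight telescopes along all walks at once.\<close>

lemma walk_weight_ge:
  assumes "\<And>x y. tree_adj T x y \<Longrightarrow> \<phi> y - \<phi> x \<le> edge_weight lam T x y"
  shows "tree_walk T u p v \<Longrightarrow> \<phi> v - \<phi> u \<le> walk_weight lam T p"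
proof (induction p arbitrary: u)
  case Nil
  then show ?case by (simp add: tree_walk_def)
next
  case (Cons x p)
  show ?case
  proof (cases p)
    case Nil
    then have "u = v" using Cons.prems by (auto simp: tree_walk_def)
    then show ?thesis using Nil by (simp add: walk_weight_def)
  next
    case (Cons y q)
    with Cons.prems have "u = x" "tree_adj T x y" "tree_walk T y p v"
      by (auto simp: tree_walk_def)
    then show ?thesis
      using Cons.IH[of y] assms[of x y] Cons by (simp add: walk_weight_Cons)
  qed
qed

lemma hsum_Suc: "hsum lam (Suc k) = hsum lam k + lam ^ k"
  by (simp add: hsum_def)

lemma hsum_mono: "j \<le> k \<Longrightarrow> hsum lam j \<le> hsum lam k"
  using lam unfolding hsum_def by (intro sum_mono2) auto

lemma hsum_nonneg: "0 \<le> hsum lam k"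
  using lam unfolding hsum_def by (intro sum_nonneg) auto

lemma hsum_le: "hsum lam k \<le> lam ^ k / (lam - 1)"
proof -
  have "hsum lam k = (lam ^ k - 1) / (lam - 1)"
    unfolding hsum_def using lam by (subst geometric_sum) auto
  also have "\<dots> \<le> lam ^ k / (lam - 1)"
    using lam by (intro divide_right_mono) auto
  finally show ?thesis .
qed

text \<open>The first alternative reflects truncated subtraction: it would occur at a vertex deeper
  than \<open>L\<close>. Admitting it saves the proof that every vertex lies above a leaf.\<close>

lemma level_parent_cases:
  assumes "v < n" "v \<noteq> rt"
  shows "level T (parent T v) = level T v \<and> level T v = 0 \<or> level T (parent T v) = Suc (level T v)"
  using depth_Suc[OF assms] by (auto simp: level_def)

text \<open>
  The potential is the height inside the subtree of the \<open>k\<close>-th ancestor of \<open>u\<close> and the height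
  reflected at level \<open>k + 1\<close> outside of it; it is 1-Lipschitz along the edges.
\<close>

lemma tree_dist_lower:
  assumes u: "u \<in> leaves T" and v: "v \<in> leaves T" and k: "k \<le> L" and ne: "anc T k u \<noteq> anc T k v"
  shows "2 * hsum lam (Suc k) \<le> tree_dist lam T u v"
proof -
  define a where "a = anc T k u"
  define sub where "sub x \<longleftrightarrow> (\<exists>j. anc T j x = a)" for x
  define \<phi> where "\<phi> x = (if sub x then hsum lam (level T x)
      else 2 * hsum lam (Suc k) - hsum lam (level T x))" for x
  have sub_parent: "sub (parent T x) \<Longrightarrow> sub x" if "x \<noteq> rt" for x
    unfolding sub_def using that by (metis add.commute anc_add anc_0 anc_Suc par_def)
  have sub_a: "x = a" if "sub x" "\<not> sub (parent T x)" "x \<noteq> rt" for x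
  proof -
    from that(1) obtain j where j: "anc T j x = a" unfolding sub_def by blast
    show ?thesis
    proof (cases j)
      case 0
      then show ?thesis using j by simp
    next
      case (Suc i)
      then have "anc T i (parent T x) = a"
        using j that anc_add[of T i 1 x] by (simp add: anc_Suc par_def)
      then show ?thesis using that by (auto simp: sub_def)
    qed
  qed
  have la: "level T a = k" using level_anc u k by (simp add: a_def)
  have step: "\<bar>\<phi> (parent T x) - \<phi> x\<bar> \<le> lam ^ min (level T x) (level T (parent T x))"
    if x: "x < n" "x \<noteq> rt" for x
  proof -
    consider "sub x = sub (parent T x)" | "x = a" "sub x" "\<not> sub (parent T x)"
      using sub_parent sub_a x by blast
    then show ?thesis
    proof cases
      case 1
      then show ?thesis using level_parent_cases[OF x] lam
        by (auto simp: \<phi>_def hsum_Suc)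
    next
      case 2
      \<comment> \<open>At the only edge that leaves the subtree the two branches of the potential
        fit together: outside, at level \<open>k + 1\<close>, the value is
        \<open>hsum lam (Suc k)\<close>, which exceeds the value \<open>hsum lam k\<close> at
        \<open>a\<close> by the edge weight.\<close>
      have "depth T a = L - k"
        using u by (simp add: a_def depth_anc leaf_lt depth_leaf)
      moreover have "depth T a = Suc (depth T (parent T a))"
        using 2 x by (simp add: depth_Suc)
      ultimately have "level T (parent T x) = Suc k"
        using 2 k by (auto simp: level_def)
      then show ?thesis using 2 la lam by (auto simp: \<phi>_def hsum_Suc)
    qed
  qed
  have lip: "\<phi> y - \<phi> x \<le> edge_weight lam T x y" if "tree_adj T x y" for x y
    using that step[of x] step[of y] by (auto simp: tree_adj_def edge_weight_def min.commute)
  have subu: "sub u" by (auto simp: sub_def a_def)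
  have subv: "\<not> sub v"
  proof
    assume "sub v"
    then obtain j where j: "anc T j v = anc T k u" by (auto simp: sub_def a_def)
    show False
    proof (cases "j \<le> L")
      case True
      then show False using anc_eq_level[OF v u _ k j] j ne by auto
    next
      case False
      then have "anc T L v = anc T k u" using j anc_ge_L[OF v, of j] anc_L[OF v] by simp
      then show False using anc_eq_level[OF v u order_refl k] ne by auto
    qed
  qed
  have "level T u = 0" "level T v = 0"
    using level_anc[OF u, of 0] level_anc[OF v, of 0] by auto
  then have \<phi>uv: "\<phi> v - \<phi> u = 2 * hsum lam (Suc k)"
    using subu subv by (simp add: \<phi>_def hsum_def)
  have "2 * hsum lam (Suc k) \<le> walk_weight lam T p" if "tree_walk T u p v" for p
    using walk_weight_ge[of \<phi>, OF lip that] \<phi>uv by simp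
  then show ?thesis
    unfolding tree_dist_def using ex_walk[OF u v] by (intro cInf_greatest) auto
qed

lemma tree_dist_nonneg:
  assumes u: "u \<in> leaves T" and v: "v \<in> leaves T"
  shows "0 \<le> tree_dist lam T u v"
proof -
  show ?thesis
    unfolding tree_dist_def using ex_walk[OF u v]
    by (intro cInf_greatest) (auto simp: walk_weight_nonneg)
qed

end

section \<open>The output determined by the marks\<close>

text \<open>Read from the leaf upward: each unmarked vertex overwrites the value by the level above
  it, as the loop \<open>find_low\<close> does.\<close>

primrec lowk :: "rtree \<Rightarrow> (nat \<Rightarrow> bool) \<Rightarrow> nat \<Rightarrow> nat \<Rightarrow> nat" where
  "lowk T m u 0 = 0"
| "lowk T m u (Suc k) = (if m (anc T k u) then lowk T m u k else Suc k)"

text \<open>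
  The root counts as marked: \<open>low_level T m u\<close> is the least level from which on all proper
  descendants of the root on the path of \<open>u\<close> are marked.  \<open>inner\<close> singles out the vertices with a
  proper descendant in the marked subtree.
\<close>

definition low_level :: "rtree \<Rightarrow> (nat \<Rightarrow> bool) \<Rightarrow> nat \<Rightarrow> nat" where
  "low_level T m u = lowk T m u (height T)"

definition low :: "rtree \<Rightarrow> (nat \<Rightarrow> bool) \<Rightarrow> nat \<Rightarrow> nat" where
  "low T m u = anc T (low_level T m u) u"

definition inner :: "rtree \<Rightarrow> (nat \<Rightarrow> bool) \<Rightarrow> nat \<Rightarrow> bool" where
  "inner T m v \<longleftrightarrow>
     (\<exists>u\<in>leaves T. \<exists>k. low_level T m u \<le> k \<and> k < height T \<and> anc T (Suc k) u = v)"

text \<open>Mirrors the repeated overwriting of an array cell by \<open>find_all\<close>: the leaf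
  of largest index wins, and 0 is the initial content of the cell.\<close>

primrec rep :: "rtree \<Rightarrow> (nat \<Rightarrow> bool) \<Rightarrow> nat \<Rightarrow> nat \<Rightarrow> nat" where
  "rep T m 0 v = 0"
| "rep T m (Suc i) v = (if i \<in> leaves T \<and> low T m i = v then i else rep T m i v)"

definition out_set :: "rtree \<Rightarrow> (nat \<Rightarrow> bool) \<Rightarrow> nat set" where
  "out_set T m =
     (\<lambda>u. rep T m (vnum T) (low T m u)) ` {u \<in> leaves T. \<not> inner T m (low T m u)}"

lemma lowk_le: "lowk T m u k \<le> k"
  by (induction k) auto

lemma lowk_le_iff: "k \<le> K \<Longrightarrow> lowk T m u K \<le> k \<longleftrightarrow> (\<forall>j. k \<le> j \<and> j < K \<longrightarrow> m (anc T j u))"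
proof (induction K)
  case 0
  then show ?case by simp
next
  case (Suc K)
  show ?case
  proof (cases "k = Suc K")
    case True
    then show ?thesis using lowk_le[of T m u "Suc K"] by auto
  next
    case False
    then have "k \<le> K" using Suc.prems by simp
    then show ?thesis
      using Suc.IH by (cases "m (anc T K u)") (auto simp: less_Suc_eq dest: spec[of _ K])
  qed
qed

context hst
begin

lemma low_level_le: "low_level T m u \<le> L"
  by (simp add: low_level_def lowk_le)

lemma low_level_le_iff:
  "k \<le> L \<Longrightarrow> low_level T m u \<le> k \<longleftrightarrow> (\<forall>j. k \<le> j \<and> j < L \<longrightarrow> m (anc T j u))"
  by (simp add: low_level_def lowk_le_iff)

lemma low_level_marked: "low_level T m u \<le> j \<Longrightarrow> j < L \<Longrightarrow> m (anc T j u)"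
  using low_level_le_iff[of j m u] by simp

lemma low_level_unmarked:
  assumes "low_level T m u = Suc k" shows "\<not> m (anc T k u)"
proof
  assume "m (anc T k u)"
  then have "m (anc T j u)" if "k \<le> j" "j < L" for j
    using low_level_marked[of m u j] that assms by (cases "j = k") auto
  then have "low_level T m u \<le> k"
    using low_level_le_iff[of k m u] low_level_le[of m u] assms by simp
  then show False using assms by simp
qed

text \<open>Whether \<open>low_level\<close> is at most \<open>k\<close> depends only on the
  ancestors from level \<open>k\<close> upward, which the two leaves share.\<close>

lemma low_level_le_transfer:
  assumes "anc T k u = anc T k v" "k \<le> L" "low_level T m u \<le> k"
  shows "low_level T m v \<le> k"
  using assms anc_mono_eq[OF assms(1)] by (auto simp: low_level_le_iff)

lemma rep_spec:
  "u \<in> leaves T \<Longrightarrow> low T m u = v \<Longrightarrow> u < i \<Longrightarrow>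
     rep T m i v \<in> leaves T \<and> low T m (rep T m i v) = v"
  by (induction i) (auto simp: less_Suc_eq)

lemma low_eqD:
  assumes "u \<in> leaves T" "v \<in> leaves T" "low T m u = low T m v"
  shows "low_level T m u = low_level T m v"
  using anc_eq_level[OF assms(1,2) low_level_le low_level_le] assms(3) by (simp add: low_def)

lemma out_set_leaves: "out_set T m \<subseteq> leaves T"
  using rep_spec leaf_lt by (auto simp: out_set_def)

text \<open>An output leaf is determined by its own lowest vertex, so two output leaves with the
  same \<open>low\<close> coincide. This decides the last case of
  \<open>nearest_out_set\<close>.\<close>

lemma out_set_iff:
  "s \<in> out_set T m \<longleftrightarrow>
     s \<in> leaves T \<and> \<not> inner T m (low T m s) \<and> rep T m n (low T m s) = s"
proof
  assume "s \<in> out_set T m"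
  then obtain u where u: "u \<in> leaves T" "\<not> inner T m (low T m u)" "s = rep T m n (low T m u)"
    by (auto simp: out_set_def)
  then show "s \<in> leaves T \<and> \<not> inner T m (low T m s) \<and> rep T m n (low T m s) = s"
    using rep_spec[OF u(1) refl leaf_lt[OF u(1)], of m] by auto
next
  assume "s \<in> leaves T \<and> \<not> inner T m (low T m s) \<and> rep T m n (low T m s) = s"
  then show "s \<in> out_set T m"
    unfolding out_set_def by (intro image_eqI[of _ _ s]) auto
qed

text \<open>Among the leaves below the given vertex take one with the least
  \<open>low_level\<close>. Its lowest vertex is not inner, since a lower vertex of the marked
  subtree would yield a leaf with smaller \<open>low_level\<close>; hence its representative is in
  the output.\<close>

lemma out_set_below:
  assumes u: "u \<in> leaves T" and k: "low_level T m u \<le> k" "k \<le> L"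
  shows "\<exists>s\<in>out_set T m. anc T k s = anc T k u"
proof -
  define P where "P i \<longleftrightarrow> (\<exists>x\<in>leaves T. anc T k x = anc T k u \<and> low_level T m x = i)" for i
  have ex: "P (low_level T m u)" using u by (auto simp: P_def)
  define i where "i = (LEAST i. P i)"
  have Pi: "P i" unfolding i_def by (rule LeastI[of P, OF ex])
  have i_min: "i \<le> j" if "P j" for j unfolding i_def by (rule Least_le[of P, OF that])
  from Pi obtain x where x: "x \<in> leaves T" "anc T k x = anc T k u" "low_level T m x = i"
    by (auto simp: P_def)
  have "i \<le> k" using i_min[OF ex] k by simp
  have "\<not> inner T m (low T m x)"
  proof
    assume "inner T m (low T m x)"
    then obtain y j where y: "y \<in> leaves T" "low_level T m y \<le> j" "j < L" "anc T (Suc j) y = low T m x"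
      by (auto simp: inner_def)
    then have ji: "Suc j = i"
      using anc_eq_level[OF y(1) x(1), of "Suc j" i] low_level_le[of m x] x(3) by (auto simp: low_def)
    then have "anc T k y = anc T k x"
      using anc_mono_eq[of T i y x k] y x \<open>i \<le> k\<close> by (auto simp: low_def)
    then have "P (low_level T m y)" using y x by (auto simp: P_def)
    then show False using i_min ji y by fastforce
  qed
  moreover define s where "s = rep T m n (low T m x)"
  have s: "s \<in> leaves T" "low T m s = low T m x"
    using rep_spec[OF x(1) refl leaf_lt[OF x(1)], of m] by (auto simp: s_def)
  then have "low_level T m s = i"
    using low_eqD[OF s(1) x(1) s(2)] x(3) by simp
  with s have "anc T k s = anc T k x"
    using anc_mono_eq[of T i s x k] s x \<open>i \<le> k\<close> by (auto simp: low_def)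
  ultimately show ?thesis
    using s x by (intro bexI[of _ s]) (auto simp: out_set_iff s_def)
qed

text \<open>An output leaf \<open>x\<close> that does not lie below the unmarked child of
  \<open>low T m u\<close> on the path of \<open>u\<close> is at least as far from \<open>u\<close>
  as the bound on \<open>d u s\<close>. If it does, then \<open>low T m u\<close> is the lowest
  vertex of \<open>x\<close> too and is not inner, so it has only one output leaf and
  \<open>x = s\<close>.\<close>

lemma nearest_out_set:
  assumes d: "\<And>u v. u \<in> leaves T \<Longrightarrow> v \<in> leaves T \<Longrightarrow> d u v = tree_dist lam T u v"
  assumes u: "u \<in> leaves T" and s: "s \<in> out_set T m"
    and eq: "anc T (low_level T m u) s = low T m u"
  shows "s \<in> nearest d (out_set T m) u" "d u s \<le> 2 * hsum lam (low_level T m u)"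
proof -
  let ?k = "low_level T m u"
  have sl: "s \<in> leaves T" using s by (simp add: out_set_iff)
  show up: "d u s \<le> 2 * hsum lam ?k"
    using tree_dist_upper[OF u sl low_level_le[of m u]] eq d[OF u sl] by (simp add: low_def)
  have "d u s \<le> d u x" if x: "x \<in> out_set T m" for x
  proof -
    have xl: "x \<in> leaves T" using x by (simp add: out_set_iff)
    have far: "2 * hsum lam (Suc j) \<le> d u x" if "j \<le> L" "anc T j u \<noteq> anc T j x" for j
      using tree_dist_lower[OF u xl that] d[OF u xl] by simp
    show ?thesis
    proof (cases "anc T ?k u = anc T ?k x")
      case False
      then show ?thesis
        using far[OF low_level_le[of m u]] hsum_mono[of ?k "Suc ?k"] up by simp
    next
      case True
      show ?thesis
      proof (cases ?k)
        case 0
        then show ?thesis using up tree_dist_nonneg[OF u xl] d[OF u xl] by (simp add: hsum_def)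
      next
        case (Suc j)
        show ?thesis
        proof (cases "anc T j u = anc T j x")
          case False
          then show ?thesis using far[of j] Suc up low_level_le[of m u] by simp
        next
          case eqj: True
          \<comment> \<open>Below a vertex that is not inner every leaf has this vertex as its
            lowest one; this is applied to \<open>s\<close>.\<close>
          have same: "low_level T m y = ?k \<and> low T m y = low T m u"
            if y: "y \<in> leaves T" "anc T ?k y = low T m u" and ni: "\<not> inner T m (low T m u)" for y
          proof -
            have le: "low_level T m y \<le> ?k"
              by (rule low_level_le_transfer[of _ u]) (use y low_level_le in \<open>auto simp: low_def\<close>)
            have "\<not> low_level T m y \<le> j"
            proof
              assume "low_level T m y \<le> j"
              then have "inner T m (low T m u)"
                unfolding inner_def using y Suc low_level_le[of m u]
                by (intro bexI[of _ y] exI[of _ j]) auto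
              then show False using ni by simp
            qed
            then have "low_level T m y = ?k" using le Suc by simp
            then show ?thesis using y by (simp add: low_def)
          qed
          have "\<not> m (anc T j x)" using low_level_unmarked[OF Suc] eqj by simp
          then have "\<not> low_level T m x \<le> j"
            using low_level_marked[of m x j] Suc low_level_le[of m u] by auto
          moreover have "low_level T m x \<le> ?k"
            by (rule low_level_le_transfer[of _ u]) (use True low_level_le in auto)
          ultimately have "low_level T m x = ?k" using Suc by simp
          then have lx: "low T m x = low T m u" using True by (simp add: low_def)
          then have ni: "\<not> inner T m (low T m u)" using x by (auto simp: out_set_iff)
          then have "low T m s = low T m u" using same[OF sl] eq by simp
          then have "s = x" using s x lx by (metis out_set_iff)
          then show ?thesis by simp
        qed
      qed
    qed
  qed
  then show "s \<in> nearest d (out_set T m) u" using s by (simp add: nearest_def)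
qed

end

section \<open>Lower bounds on the optimum from antichains\<close>

locale hst_ufl = hst +
  fixes f :: real and N :: "nat \<Rightarrow> nat" and d :: "nat \<Rightarrow> nat \<Rightarrow> real"
  assumes f: "0 \<le> f"
    and d: "\<And>u v. u \<in> leaves T \<Longrightarrow> v \<in> leaves T \<Longrightarrow> d u v = tree_dist lam T u v"
begin

text \<open>Stated through leaves so that each member comes with a leaf below it and thus has an
  exact level by \<open>level_anc\<close>.\<close>

definition Vx :: "nat set" where
  "Vx = {anc T k u |k u. k \<le> L \<and> u \<in> leaves T}"

definition below :: "nat \<Rightarrow> nat set" where
  "below v = {u \<in> leaves T. anc T (level T v) u = v}"

definition cn :: "nat \<Rightarrow> nat" where
  "cn v = (\<Sum>u\<in>below v. N u)"

text \<open>What any solution must spend on the clients below \<open>v\<close>: either a facility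
  below \<open>v\<close>, or for each of these clients at least the weight of the edge above
  \<open>v\<close>. At the root only the first is possible.\<close>

definition benefit :: "nat \<Rightarrow> real" where
  "benefit v = (if cn v = 0 then 0 else if level T v = L then f
     else min f (real (cn v) * lam ^ level T v))"

abbreviation "cost \<equiv> ufl_cost (leaves T) d f N"

lemma finite_Vx: "finite Vx"
proof -
  have "Vx = (\<lambda>(k, u). anc T k u) ` ({..L} \<times> leaves T)"
    by (auto simp: Vx_def image_iff)
  then show ?thesis using finite_leaves by simp
qed

lemma finite_below: "finite (below v)"
  using finite_leaves by (simp add: below_def)

lemma below_anc: "u \<in> leaves T \<Longrightarrow> k \<le> L \<Longrightarrow> below (anc T k u) = {x \<in> leaves T. anc T k x = anc T k u}"
  by (simp add: below_def level_anc)

lemma level_le: "level T v \<le> L"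
  by (simp add: level_def)

lemma benefit_nonneg: "0 \<le> benefit v"
  using f lam by (simp add: benefit_def)

lemma benefit_le: "benefit v \<le> f"
  using f by (simp add: benefit_def)

lemma benefit_le_cn: "level T v < L \<Longrightarrow> benefit v \<le> real (cn v) * lam ^ level T v"
  by (simp add: benefit_def)

lemma cost_empty:
  assumes "u \<in> leaves T" "0 < N u" shows "cost {} = \<infinity>"
proof -
  have "of_nat (N u) * set_dist d u {} \<le> (\<Sum>v\<in>leaves T. of_nat (N v) * set_dist d v {})"
    using assms finite_leaves by (intro member_le_sum) auto
  moreover have "of_nat (N u) * set_dist d u {} = (top :: ennreal)"
    using assms by (simp add: set_dist_def ennreal_mult_eq_top_iff)
  ultimately show ?thesis by (simp add: ufl_cost_def top_unique)
qed

lemma set_dist_ge: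
  assumes S: "S \<subseteq> leaves T" and v: "S \<inter> below v = {}" and u: "u \<in> below v"
  shows "ennreal (lam ^ level T v) \<le> set_dist d u S"
  unfolding set_dist_def
proof (rule INF_greatest)
  fix s assume "s \<in> S"
  then have s: "s \<in> leaves T" "anc T (level T v) u \<noteq> anc T (level T v) s"
    using S v u by (auto simp: below_def)
  have ul: "u \<in> leaves T" using u by (simp add: below_def)
  have "lam ^ level T v \<le> 2 * hsum lam (Suc (level T v))"
    using hsum_nonneg[of "level T v"] lam by (simp add: hsum_Suc)
  also have "\<dots> \<le> d u s"
    using tree_dist_lower[OF ul s(1) level_le s(2)] d[OF ul s(1)] by simp
  finally show "ennreal (lam ^ level T v) \<le> ennreal (d u s)" by (rule ennreal_leI)
qed

text \<open>Vertices of the antichain with a facility of \<open>S\<close> below them pay by that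
  facility, and disjointness makes the choice of facilities injective. The other vertices pay by the
  connections of their own clients, which are disjoint parts of the connection cost.\<close>

lemma antichain_bound:
  assumes A: "A \<subseteq> Vx" "disjoint_family_on below A" and S: "S \<subseteq> leaves T"
  shows "ennreal (\<Sum>v\<in>A. benefit v) \<le> cost S"
proof (cases "S = {}")
  case True
  show ?thesis
  proof (cases "\<exists>u\<in>leaves T. 0 < N u")
    case True
    then show ?thesis using cost_empty \<open>S = {}\<close> by auto
  next
    case False
    then have "cn v = 0" for v by (auto simp: cn_def below_def)
    then show ?thesis by (simp add: benefit_def)
  qed
next
  case False
  have finA: "finite A" using A finite_Vx finite_subset by blast
  have finS: "finite S" using S finite_leaves finite_subset by blast
  define A1 where "A1 = {v \<in> A. S \<inter> below v \<noteq> {}}"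
  define A2 where "A2 = A - A1"
  have disj: "below v \<inter> below w = {}" if "v \<in> A" "w \<in> A" "v \<noteq> w" for v w
    using A(2) that by (auto simp: disjoint_family_on_def)
  define h where "h v = (SOME s. s \<in> S \<inter> below v)" for v
  have h: "h v \<in> S \<inter> below v" if "v \<in> A1" for v
    unfolding h_def by (rule someI_ex) (use that in \<open>auto simp: A1_def\<close>)
  have "inj_on h A1"
  proof (rule inj_onI, rule ccontr)
    fix v w assume vw: "v \<in> A1" "w \<in> A1" "h v = h w" "v \<noteq> w"
    then have "h v \<in> below v \<inter> below w" using h[of v] h[of w] by auto
    moreover have "below v \<inter> below w = {}" using disj vw by (simp add: A1_def)
    ultimately show False by blast
  qed
  then have card: "card A1 \<le> card S"
    by (rule card_inj_on_le) (use h finS in auto)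
  have "(\<Sum>v\<in>A1. benefit v) \<le> real (card S) * f"
    using sum_bounded_above[of A1 benefit f] benefit_le card f
    by (meson mult_right_mono of_nat_le_iff order_trans)
  then have 1: "ennreal (\<Sum>v\<in>A1. benefit v) \<le> of_nat (card S) * ennreal f"
    using f by (simp add: ennreal_of_nat_eq_real_of_nat ennreal_leI flip: ennreal_mult)
  have 2: "ennreal (benefit v) \<le> (\<Sum>u\<in>below v. of_nat (N u) * set_dist d u S)" if v: "v \<in> A2" for v
  proof -
    have "S \<inter> below v = {}" using v by (auto simp: A1_def A2_def)
    \<comment> \<open>All leaves lie below the root, so a nonempty \<open>S\<close> puts the root
      into \<open>A1\<close>.\<close>
    have "level T v \<noteq> L"
    proof
      assume "level T v = L"
      moreover obtain k x where "v = anc T k x" "k \<le> L" "x \<in> leaves T"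
        using v A by (auto simp: A2_def Vx_def)
      ultimately have "v = rt" using level_anc anc_L by auto
      moreover obtain s where "s \<in> S" using False by auto
      ultimately have "s \<in> below v" using anc_L S \<open>level T v = L\<close> by (auto simp: below_def)
      then show False using \<open>s \<in> S\<close> \<open>S \<inter> below v = {}\<close> by auto
    qed
    then have "benefit v \<le> real (cn v) * lam ^ level T v"
      using benefit_le_cn level_le[of v] by simp
    then have "ennreal (benefit v) \<le> of_nat (cn v) * ennreal (lam ^ level T v)"
      using lam by (simp add: ennreal_of_nat_eq_real_of_nat ennreal_leI flip: ennreal_mult)
    also have "\<dots> = (\<Sum>u\<in>below v. of_nat (N u) * ennreal (lam ^ level T v))"
      by (simp add: cn_def sum_distrib_right)
    also have "\<dots> \<le> (\<Sum>u\<in>below v. of_nat (N u) * set_dist d u S)"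
      using set_dist_ge[OF S \<open>S \<inter> below v = {}\<close>] by (intro sum_mono mult_left_mono) auto
    finally show ?thesis .
  qed
  have "(\<Sum>v\<in>A2. ennreal (benefit v)) \<le> (\<Sum>v\<in>A2. \<Sum>u\<in>below v. of_nat (N u) * set_dist d u S)"
    by (rule sum_mono) (rule 2)
  also have "\<dots> = (\<Sum>u\<in>(\<Union>v\<in>A2. below v). of_nat (N u) * set_dist d u S)"
    by (rule sum.UNION_disjoint[symmetric]) (use finA finite_below disj in \<open>auto simp: A2_def\<close>)
  also have "\<dots> \<le> (\<Sum>u\<in>leaves T. of_nat (N u) * set_dist d u S)"
    by (rule sum_mono2) (auto simp: finite_leaves below_def)
  finally have 3: "ennreal (\<Sum>v\<in>A2. benefit v) \<le> (\<Sum>u\<in>leaves T. of_nat (N u) * set_dist d u S)"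
    by (simp add: sum_ennreal benefit_nonneg)
  have "(\<Sum>v\<in>A. benefit v) = (\<Sum>v\<in>A1. benefit v) + (\<Sum>v\<in>A2. benefit v)"
    using finA unfolding A2_def by (subst sum.subset_diff[of A1 A]) (auto simp: A1_def)
  then have "ennreal (\<Sum>v\<in>A. benefit v) = ennreal (\<Sum>v\<in>A1. benefit v) + ennreal (\<Sum>v\<in>A2. benefit v)"
    by (simp add: ennreal_plus sum_nonneg benefit_nonneg)
  then show ?thesis using 1 3 by (simp add: ufl_cost_def add_mono)
qed

abbreviation "opt \<equiv> ufl_opt (leaves T) d f N"

lemma antichain_opt:
  assumes "A \<subseteq> Vx" "disjoint_family_on below A"
  shows "ennreal (\<Sum>v\<in>A. benefit v) \<le> opt"
  unfolding ufl_opt_def by (rule INF_greatest) (use antichain_bound[OF assms] in auto)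

lemma opt_finite: "leaves T \<noteq> {} \<Longrightarrow> opt < \<infinity>"
proof -
  assume ne: "leaves T \<noteq> {}"
  have "set_dist d u (leaves T) < \<infinity>" if "u \<in> leaves T" for u
    unfolding set_dist_def using that by (auto simp: INF_less_iff)
  then have "cost (leaves T) < \<infinity>"
    using finite_leaves by (auto simp: ufl_cost_def ennreal_mult_less_top of_nat_less_top)
  moreover have "opt \<le> cost (leaves T)"
    unfolding ufl_opt_def by (rule INF_lower) auto
  ultimately show ?thesis by (rule order_le_less_trans[rotated])
qed

end

section \<open>Cost of the output\<close>

context hst_ufl
begin

text \<open>The coin of a vertex is fair when \<open>\<epsilon> * cn v * lam ^ level T v\<close>
  equals \<open>f\<close>. The cutoffs \<open>f / 2\<close> here and \<open>2 * f\<close> in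
  \<open>crowded\<close> leave a factor 2 on either side, so that beyond them the larger of the two
  terms in the exponent is cancelled at most by half. Vertices between the cutoffs are affordable
  with or without a mark.\<close>

definition sig :: "real \<Rightarrow> nat \<Rightarrow> bool" where
  "sig \<epsilon> v \<longleftrightarrow> level T v = L \<or> f \<le> lam ^ level T v \<or> f / 2 \<le> \<epsilon> * real (cn v) * lam ^ level T v"

text \<open>The vertices at which a mark is a mistake that can cost a facility. At the vertices of
  \<open>crowded\<close> the missing mark is the mistake.\<close>

definition bad :: "real \<Rightarrow> nat set" where
  "bad \<epsilon> = {v \<in> Vx. \<not> sig \<epsilon> v \<and> 0 < cn v}"

definition crowded :: "real \<Rightarrow> nat set" where
  "crowded \<epsilon> = {v \<in> Vx. level T v < L \<and> lam ^ level T v < f \<and>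
     2 * f < \<epsilon> * real (cn v) * lam ^ level T v}"

lemma cn_pos: "u \<in> leaves T \<Longrightarrow> k \<le> L \<Longrightarrow> 0 < N u \<Longrightarrow> 0 < cn (anc T k u)"
  using member_le_sum[of u "below (anc T k u)" N] finite_leaves by (simp add: cn_def below_anc)

text \<open>
  Ties are broken as follows: a client whose lowest ancestor in the marked subtree is significant
  uses the facility of a minimal significant vertex below that ancestor, so that the crowded leaf
  below a chain of heavy ancestors serves the light clients of the whole chain.
\<close>

definition minimal_sig :: "real \<Rightarrow> (nat \<Rightarrow> bool) \<Rightarrow> nat set" where
  "minimal_sig \<epsilon> m = {anc T k x |k x. x \<in> leaves T \<and> 0 < N x \<and> low_level T m x \<le> k \<and> k \<le> L \<and>
     sig \<epsilon> (anc T k x) \<and>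
     (\<forall>y\<in>leaves T. \<forall>j\<le>L. 0 < N y \<and> anc T k y = anc T k x \<and> low_level T m y \<le> j \<and>
        sig \<epsilon> (anc T j y) \<longrightarrow> k \<le> j)}"

lemma minimal_sigE:
  assumes "v \<in> minimal_sig \<epsilon> m"
  obtains k x where "v = anc T k x" "x \<in> leaves T" "0 < N x" "low_level T m x \<le> k" "k \<le> L" "sig \<epsilon> v"
    "\<And>y j. y \<in> leaves T \<Longrightarrow> j \<le> L \<Longrightarrow> 0 < N y \<Longrightarrow> anc T k y = v \<Longrightarrow> low_level T m y \<le> j \<Longrightarrow>
      sig \<epsilon> (anc T j y) \<Longrightarrow> k \<le> j"
proof -
  from assms obtain k x where x: "v = anc T k x" "x \<in> leaves T" "0 < N x" "low_level T m x \<le> k"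
      "k \<le> L" "sig \<epsilon> (anc T k x)"
    and min: "\<forall>y\<in>leaves T. \<forall>j\<le>L. 0 < N y \<and> anc T k y = anc T k x \<and> low_level T m y \<le> j \<and>
        sig \<epsilon> (anc T j y) \<longrightarrow> k \<le> j"
    unfolding minimal_sig_def by blast
  show thesis
    by (rule that[OF x(1-5)]) (use x min in blast)+
qed

lemma minimal_sig_Vx: "minimal_sig \<epsilon> m \<subseteq> Vx"
  by (auto simp: minimal_sig_def Vx_def)

text \<open>Two vertices have a common leaf below them only if both lie on its root path, so it
  suffices to exclude two members on one path.\<close>

lemma disjoint_belowI:
  assumes "A \<subseteq> Vx"
    and "\<And>j k x. x \<in> leaves T \<Longrightarrow> j < k \<Longrightarrow> k \<le> L \<Longrightarrow> anc T j x \<in> A \<Longrightarrow> anc T k x \<in> A \<Longrightarrow> False"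
  shows "disjoint_family_on below A"
  unfolding disjoint_family_on_def
proof (intro ballI impI)
  fix v w assume vw: "v \<in> A" "w \<in> A" "v \<noteq> w"
  have "False" if x: "x \<in> below v" "x \<in> below w" for x
  proof -
    have "anc T (level T v) x = v" "anc T (level T w) x = w" "x \<in> leaves T"
      using x by (auto simp: below_def)
    then show False
      using assms(2)[of x "level T v" "level T w"] assms(2)[of x "level T w" "level T v"] vw
        level_le[of v] level_le[of w] by (metis linorder_neqE_nat)
  qed
  then show "below v \<inter> below w = {}" by blast
qed

lemma minimal_sig_disjoint: "disjoint_family_on below (minimal_sig \<epsilon> m)"
proof (rule disjoint_belowI[OF minimal_sig_Vx])
  fix i j x assume x: "x \<in> leaves T" "i < j" "j \<le> L"
    and i: "anc T i x \<in> minimal_sig \<epsilon> m" and j: "anc T j x \<in> minimal_sig \<epsilon> m"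
  obtain k y where y: "anc T i x = anc T k y" "y \<in> leaves T" "0 < N y" "low_level T m y \<le> k" "k \<le> L"
      "sig \<epsilon> (anc T i x)"
    using i by (rule minimal_sigE)
  obtain l z where z: "anc T j x = anc T l z" "z \<in> leaves T" "l \<le> L"
      "\<And>y i. y \<in> leaves T \<Longrightarrow> i \<le> L \<Longrightarrow> 0 < N y \<Longrightarrow> anc T l y = anc T j x \<Longrightarrow> low_level T m y \<le> i \<Longrightarrow>
        sig \<epsilon> (anc T i y) \<Longrightarrow> l \<le> i"
    using j by (rule minimal_sigE) blast
  have k: "i = k" using anc_eq_level[OF x(1) y(2) _ y(5) y(1)] x by simp
  have l: "j = l" using anc_eq_level[OF x(1) z(2) x(3) z(3) z(1)] by simp
  have "anc T j x = anc T j y"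
    using anc_mono_eq[of T i x y j] y k x by simp
  then have "j \<le> i" using z(4)[OF y(2), of i] y x k l by simp
  then show False using x by simp
qed

text \<open>Take a significant vertex of the marked subtree, with a client below it, on the least
  possible level below \<open>low T m u\<close>; the vertex itself is a candidate.\<close>

lemma minimal_sig_exists:
  assumes u: "u \<in> leaves T" "0 < N u" and s: "sig \<epsilon> (low T m u)"
  shows "\<exists>k x. x \<in> leaves T \<and> anc T k x \<in> minimal_sig \<epsilon> m \<and> low_level T m x \<le> k \<and>
    k \<le> low_level T m u \<and> anc T (low_level T m u) x = low T m u"
proof -
  let ?K = "low_level T m u"
  define P where "P k \<longleftrightarrow> k \<le> ?K \<and> (\<exists>x\<in>leaves T. 0 < N x \<and> low_level T m x \<le> k \<and>
      sig \<epsilon> (anc T k x) \<and> anc T ?K x = low T m u)" for k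
  have ex: "P ?K" using u s by (auto simp: P_def low_def intro!: bexI[of _ u])
  define k where "k = (LEAST k. P k)"
  have Pk: "P k" unfolding k_def by (rule LeastI[of P, OF ex])
  have k_min: "k \<le> j" if "P j" for j unfolding k_def by (rule Least_le[of P, OF that])
  from Pk obtain x where x: "x \<in> leaves T" "0 < N x" "low_level T m x \<le> k" "sig \<epsilon> (anc T k x)"
      "anc T ?K x = low T m u" "k \<le> ?K"
    by (auto simp: P_def)
  have "k \<le> j" if y: "y \<in> leaves T" "j \<le> L" "0 < N y" "anc T k y = anc T k x" "low_level T m y \<le> j"
      "sig \<epsilon> (anc T j y)" for y j
  proof (rule ccontr)
    assume "\<not> k \<le> j"
    moreover have "anc T ?K y = low T m u" using anc_mono_eq[OF y(4) x(6)] x(5) by simp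
    ultimately have "P j" using y x(6) by (auto simp: P_def)
    then show False using k_min \<open>\<not> k \<le> j\<close> by auto
  qed
  then have "anc T k x \<in> minimal_sig \<epsilon> m"
    unfolding minimal_sig_def mem_Collect_eq using x low_level_le[of m u]
    by - (rule exI[of _ k], rule exI[of _ x], auto)
  then show ?thesis using x by blast
qed

text \<open>Each vertex \<open>v\<close> of \<open>minimal_sig\<close> or marked vertex of
  \<open>bad\<close> contributes one output leaf \<open>S v\<close>. Every client finds one of these
  leaves below its lowest vertex, and by \<open>nearest_out_set\<close> connecting to it is
  legitimate.\<close>

lemma superset_cost_le:
  assumes \<epsilon>: "0 \<le> \<epsilon>"
  shows "superset_cost (leaves T) d f N (out_set T m) \<le>
    ennreal (f * card (minimal_sig \<epsilon> m) + f * card {v \<in> bad \<epsilon>. m v} +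
      (\<Sum>u\<in>leaves T. real (N u) * (2 * hsum lam (low_level T m u))))"
proof -
  define S where "S v = (SOME s. s \<in> out_set T m \<and> anc T (level T v) s = v)" for v
  have S: "S (anc T k x) \<in> out_set T m \<and> anc T k (S (anc T k x)) = anc T k x"
    if "x \<in> leaves T" "low_level T m x \<le> k" "k \<le> L" for k x
  proof -
    have "\<exists>s. s \<in> out_set T m \<and> anc T (level T (anc T k x)) s = anc T k x"
      using out_set_below[OF that] that by (auto simp: level_anc)
    from someI_ex[OF this] show ?thesis
      unfolding S_def using that by (simp add: level_anc)
  qed
  let ?Z = "minimal_sig \<epsilon> m" and ?B = "{v \<in> bad \<epsilon>. m v}"
  have ex: "\<exists>v\<in>?Z \<union> ?B. S v \<in> out_set T m \<and> anc T (low_level T m u) (S v) = low T m u"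
    if u: "u \<in> leaves T" "0 < N u" for u
  proof (cases "sig \<epsilon> (low T m u)")
    case True
    obtain k x where x: "x \<in> leaves T" "anc T k x \<in> ?Z" "low_level T m x \<le> k"
        "k \<le> low_level T m u" "anc T (low_level T m u) x = low T m u"
      using minimal_sig_exists[OF u True] by blast
    have k: "k \<le> L" using x low_level_le[of m u] by simp
    have "anc T k (S (anc T k x)) = anc T k x" using S[OF x(1,3) k] by simp
    then have "anc T (low_level T m u) (S (anc T k x)) = low T m u"
      using anc_mono_eq[OF _ x(4)] x(5) by metis
    then show ?thesis using x(2) S[OF x(1,3) k] by blast
  next
    case False
    \<comment> \<open>The root is always significant, so an insignificant lowest vertex lies
      strictly below it and carries a mark of its own.\<close>
    have K: "low_level T m u < L"
      using False low_level_le[of m u] by (auto simp: low_def sig_def level_anc u)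
    have "low T m u \<in> Vx" using u low_level_le[of m u] by (auto simp: low_def Vx_def)
    moreover have "0 < cn (low T m u)" using cn_pos[OF u(1) low_level_le u(2)] by (simp add: low_def)
    moreover have "m (low T m u)" using low_level_marked[OF order_refl K] by (simp add: low_def)
    ultimately have "low T m u \<in> ?B" using False by (auto simp: bad_def)
    moreover have "S (low T m u) \<in> out_set T m \<and> anc T (low_level T m u) (S (low T m u)) = low T m u"
      using S[OF u(1) order_refl low_level_le] by (simp add: low_def)
    ultimately show ?thesis by blast
  qed
  define g where "g u = S (SOME v. v \<in> ?Z \<union> ?B \<and> S v \<in> out_set T m \<and>
      anc T (low_level T m u) (S v) = low T m u)" for u
  have g: "g u \<in> S ` (?Z \<union> ?B) \<and> g u \<in> out_set T m \<and> anc T (low_level T m u) (g u) = low T m u"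
    if "u \<in> leaves T" "0 < N u" for u
  proof -
    have "\<exists>v. v \<in> ?Z \<union> ?B \<and> S v \<in> out_set T m \<and> anc T (low_level T m u) (S v) = low T m u"
      using ex[OF that] by blast
    from someI_ex[OF this] show ?thesis unfolding g_def by blast
  qed
  have near: "g u \<in> nearest d (out_set T m) u" "d u (g u) \<le> 2 * hsum lam (low_level T m u)"
    if "u \<in> leaves T" "0 < N u" for u
    using nearest_out_set[OF d that(1), of "g u" m] g[OF that] by auto
  let ?O = "opened (leaves T) N g"
  have fin: "finite (?Z \<union> ?B)"
    using finite_Vx minimal_sig_Vx[of \<epsilon> m] finite_subset by (auto simp: bad_def)
  have "card ?O \<le> card (S ` (?Z \<union> ?B))"
    using g fin by (intro card_mono) (auto simp: opened_def)
  also have "\<dots> \<le> card ?Z + card ?B"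
    using card_image_le[OF fin, of S] card_Un_le[of ?Z ?B] by linarith
  finally have "real (card ?O) * f \<le> (real (card ?Z) + real (card ?B)) * f"
    using f by (intro mult_right_mono) auto
  then have 1: "of_nat (card ?O) * ennreal f \<le> ennreal (f * card ?Z + f * card ?B)"
    using f by (simp add: ennreal_of_nat_eq_real_of_nat ennreal_leI algebra_simps
        del: ennreal_plus flip: ennreal_mult)
  have "of_nat (N u) * set_dist d u ?O \<le> ennreal (real (N u) * (2 * hsum lam (low_level T m u)))"
    if u: "u \<in> leaves T" for u
  proof (cases "N u = 0")
    case False
    then have "set_dist d u ?O \<le> ennreal (d u (g u))"
      unfolding set_dist_def using u by (intro INF_lower) (auto simp: opened_def)
    also have "\<dots> \<le> ennreal (2 * hsum lam (low_level T m u))"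
      using near(2)[OF u] False by (intro ennreal_leI) simp
    finally have "of_nat (N u) * set_dist d u ?O \<le> of_nat (N u) * ennreal (2 * hsum lam (low_level T m u))"
      by (rule mult_left_mono) simp
    then show ?thesis
      using hsum_nonneg by (simp add: ennreal_of_nat_eq_real_of_nat flip: ennreal_mult)
  qed simp
  then have "(\<Sum>u\<in>leaves T. of_nat (N u) * set_dist d u ?O) \<le>
      (\<Sum>u\<in>leaves T. ennreal (real (N u) * (2 * hsum lam (low_level T m u))))"
    by (intro sum_mono)
  also have "\<dots> = ennreal (\<Sum>u\<in>leaves T. real (N u) * (2 * hsum lam (low_level T m u)))"
    using hsum_nonneg by (intro sum_ennreal) auto
  finally have 2: "(\<Sum>u\<in>leaves T. of_nat (N u) * set_dist d u ?O) \<le> \<dots>" .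
  have "superset_cost (leaves T) d f N (out_set T m) \<le> cost ?O"
    unfolding superset_cost_def
    by (rule INF_lower) (use near in \<open>auto simp: nearest_connection_def\<close>)
  also have "\<dots> \<le> ennreal (f * card ?Z + f * card ?B) +
      ennreal (\<Sum>u\<in>leaves T. real (N u) * (2 * hsum lam (low_level T m u)))"
    unfolding ufl_cost_def using 1 2 by (rule add_mono)
  also have "\<dots> = ennreal (f * card ?Z + f * card ?B +
      (\<Sum>u\<in>leaves T. real (N u) * (2 * hsum lam (low_level T m u))))"
    using f hsum_nonneg by (intro ennreal_plus[symmetric]) (auto intro!: sum_nonneg)
  finally show ?thesis .
qed

text \<open>Each reason for being significant makes the benefit at least \<open>f / 2\<close>: at
  the root it is \<open>f\<close>, for \<open>f \<le> lam ^ level T v\<close> a single client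
  suffices, and in the third case \<epsilon> \<le> 1 allows dropping \<epsilon> from the
  inequality.\<close>

lemma minimal_sig_le:
  assumes \<epsilon>: "0 \<le> \<epsilon>" "\<epsilon> \<le> 1"
  shows "f * card (minimal_sig \<epsilon> m) \<le> 2 * (\<Sum>v\<in>minimal_sig \<epsilon> m. benefit v)"
proof -
  have "f \<le> 2 * benefit v" if "v \<in> minimal_sig \<epsilon> m" for v
  proof -
    from that obtain k x where x: "v = anc T k x" "x \<in> leaves T" "0 < N x" "k \<le> L" "sig \<epsilon> v"
      by (rule minimal_sigE)
    have c: "0 < cn v" using cn_pos[OF x(2,4,3)] x(1) by simp
    then have 1: "lam ^ level T v \<le> real (cn v) * lam ^ level T v"
      using lam by simp
    have 2: "\<epsilon> * real (cn v) * lam ^ level T v \<le> 1 * real (cn v) * lam ^ level T v"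
      using \<epsilon> lam by (intro mult_right_mono) auto
    have "level T v = L \<or> f / 2 \<le> real (cn v) * lam ^ level T v"
      using x(5) 1 2 f unfolding sig_def mult_1 by argo
    then show ?thesis using c f by (auto simp: benefit_def)
  qed
  then have "(\<Sum>v\<in>minimal_sig \<epsilon> m. f) \<le> (\<Sum>v\<in>minimal_sig \<epsilon> m. 2 * benefit v)"
    by (rule sum_mono)
  then show ?thesis by (simp add: sum_distrib_left mult.commute)
qed

section \<open>Connection cost charged to the topmost unmarked vertices\<close>

definition top_unmarked :: "(nat \<Rightarrow> bool) \<Rightarrow> nat set" where
  "top_unmarked m = (\<lambda>u. anc T (low_level T m u - 1) u) ` {u \<in> leaves T. 0 < low_level T m u}"

lemma top_unmarkedE:
  assumes "v \<in> top_unmarked m"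
  obtains u k where "u \<in> leaves T" "low_level T m u = Suc k" "k < L" "v = anc T k u" "\<not> m v"
proof -
  obtain u where u: "u \<in> leaves T" "0 < low_level T m u" "v = anc T (low_level T m u - 1) u"
    using assms by (auto simp: top_unmarked_def)
  then obtain k where k: "low_level T m u = Suc k" by (cases "low_level T m u") auto
  then show ?thesis
    using that[of u k] u low_level_unmarked[OF k] low_level_le[of m u] by simp
qed

lemma top_unmarked_Vx: "top_unmarked m \<subseteq> Vx"
  by (auto simp: Vx_def elim!: top_unmarkedE intro: less_imp_le_nat)

text \<open>Strictly between a topmost unmarked vertex and the root all vertices are marked, so no
  path carries two of them.\<close>

lemma top_unmarked_disjoint: "disjoint_family_on below (top_unmarked m)"
proof (rule disjoint_belowI[OF top_unmarked_Vx])
  fix i j x assume x: "x \<in> leaves T" "i < j" "j \<le> L"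
    and i: "anc T i x \<in> top_unmarked m" and j: "anc T j x \<in> top_unmarked m"
  obtain u k where u: "u \<in> leaves T" "low_level T m u = Suc k" "k < L" "anc T i x = anc T k u"
    using i by (rule top_unmarkedE)
  obtain u' k' where u': "u' \<in> leaves T" "k' < L" "anc T j x = anc T k' u'" "\<not> m (anc T j x)"
    using j by (rule top_unmarkedE)
  have ik: "i = k" using anc_eq_level[OF x(1) u(1) _ _ u(4)] u x by simp
  have "j = k'" using anc_eq_level[OF x(1) u'(1) x(3) _ u'(3)] u' by simp
  then have "m (anc T j u)" using low_level_marked[of m u j] u u' x ik by simp
  moreover have "anc T j u = anc T j x" using anc_mono_eq[of T i u x j] u ik x by simp
  ultimately show False using u' by simp
qed

text \<open>If the topmost unmarked ancestor has level \<open>k\<close>, the client travels up to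
  level \<open>k + 1\<close> and down again, which costs at most
  \<open>2 * lam ^ (k + 1) / (lam - 1)\<close> by the geometric sum. The clients are then grouped by
  this ancestor.\<close>

lemma connection_le:
  "(\<Sum>u\<in>leaves T. real (N u) * (2 * hsum lam (low_level T m u))) \<le>
     2 * lam / (lam - 1) * (\<Sum>v\<in>top_unmarked m. real (cn v) * lam ^ level T v)"
proof -
  let ?U = "{u \<in> leaves T. 0 < low_level T m u}"
  let ?t = "\<lambda>u. anc T (low_level T m u - 1) u"
  let ?c = "2 * lam / (lam - 1)"
  have c: "0 \<le> ?c" using lam by simp
  have lev: "level T (?t u) = low_level T m u - 1" if "u \<in> leaves T" for u
    using level_anc[OF that, of "low_level T m u - 1"] low_level_le[of m u] by simp
  have "(\<Sum>u\<in>leaves T. real (N u) * (2 * hsum lam (low_level T m u))) =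
      (\<Sum>u\<in>?U. real (N u) * (2 * hsum lam (low_level T m u)))"
    using finite_leaves by (intro sum.mono_neutral_right) (auto simp: hsum_def)
  also have "\<dots> \<le> (\<Sum>u\<in>?U. ?c * (real (N u) * lam ^ level T (?t u)))"
  proof (rule sum_mono)
    fix u assume u: "u \<in> ?U"
    then obtain k where k: "low_level T m u = Suc k" by (cases "low_level T m u") auto
    have "2 * hsum lam (Suc k) \<le> ?c * lam ^ k"
      using mult_left_mono[OF hsum_le[of "Suc k"], of 2] by (simp add: mult_ac)
    then have "real (N u) * (2 * hsum lam (Suc k)) \<le> real (N u) * (?c * lam ^ k)"
      by (intro mult_left_mono) auto
    then show "real (N u) * (2 * hsum lam (low_level T m u)) \<le> ?c * (real (N u) * lam ^ level T (?t u))"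
      using lev[of u] u k by (simp add: mult_ac)
  qed
  also have "\<dots> = ?c * (\<Sum>v\<in>top_unmarked m. \<Sum>u\<in>{u \<in> ?U. ?t u = v}. real (N u) * lam ^ level T (?t u))"
    unfolding top_unmarked_def using finite_leaves
    by (subst sum.image_gen[where g = ?t]) (auto simp: sum_distrib_left)
  also have "\<dots> \<le> ?c * (\<Sum>v\<in>top_unmarked m. real (cn v) * lam ^ level T v)"
  proof (intro mult_left_mono[OF _ c] sum_mono)
    fix v assume "v \<in> top_unmarked m"
    have "(\<Sum>u\<in>{u \<in> ?U. ?t u = v}. real (N u) * lam ^ level T (?t u)) =
        (\<Sum>u\<in>{u \<in> ?U. ?t u = v}. real (N u)) * lam ^ level T v"
      by (simp add: sum_distrib_right)
    also have "\<dots> \<le> (\<Sum>u\<in>below v. real (N u)) * lam ^ level T v"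
      using lam lev finite_below by (intro mult_right_mono sum_mono2) (auto simp: below_def)
    finally show "(\<Sum>u\<in>{u \<in> ?U. ?t u = v}. real (N u) * lam ^ level T (?t u)) \<le>
        real (cn v) * lam ^ level T v"
      by (simp add: cn_def)
  qed
  finally show ?thesis .
qed

text \<open>An unmarked vertex that is not crowded has weighted count at most
  \<open>2 * f / \<epsilon>\<close>. If its benefit is \<open>f\<close>, this is the claim;
  otherwise the benefit is the weighted count itself and 2 / \<epsilon> is at least 1.\<close>

lemma top_unmarked_le:
  assumes \<epsilon>: "0 < \<epsilon>" "\<epsilon> \<le> 1"
    and m: "\<And>v. v \<in> Vx \<Longrightarrow> f \<le> lam ^ level T v \<Longrightarrow> m v"
  shows "(\<Sum>v\<in>top_unmarked m. real (cn v) * lam ^ level T v) \<le>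
    2 / \<epsilon> * (\<Sum>v\<in>top_unmarked m. benefit v) +
      (\<Sum>v\<in>{v \<in> crowded \<epsilon>. \<not> m v}. real (cn v) * lam ^ level T v)"
proof -
  let ?w = "\<lambda>v. real (cn v) * lam ^ level T v"
  have w0: "0 \<le> ?w v" for v using lam by simp
  have finU: "finite (top_unmarked m)" using finite_Vx top_unmarked_Vx finite_subset by blast
  have finH: "finite {v \<in> crowded \<epsilon>. \<not> m v}" using finite_Vx by (simp add: crowded_def)
  have 1: "?w v \<le> 2 / \<epsilon> * benefit v + (if v \<in> crowded \<epsilon> then ?w v else 0)" if v: "v \<in> top_unmarked m" for v
  proof (cases "v \<in> crowded \<epsilon> \<or> cn v = 0")
    case True
    then show ?thesis using benefit_nonneg[of v] \<epsilon> w0[of v] by auto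
  next
    case False
    obtain u k where u: "u \<in> leaves T" "k < L" "v = anc T k u" "\<not> m v"
      using v by (rule top_unmarkedE)
    have vV: "v \<in> Vx" using v top_unmarked_Vx by auto
    have lev: "level T v < L" using u by (simp add: level_anc)
    have lt: "lam ^ level T v < f" using m[OF vV] u(4) by force
    then have le: "\<epsilon> * ?w v \<le> 2 * f" using False vV lev by (auto simp: crowded_def mult.assoc)
    have "?w v * \<epsilon> \<le> 2 * benefit v"
    proof (cases "f \<le> ?w v")
      case True
      then show ?thesis using le False lev by (simp add: benefit_def mult.commute)
    next
      case F: False
      have "?w v * \<epsilon> \<le> ?w v * 2" using w0[of v] \<epsilon> by (intro mult_left_mono) auto
      then show ?thesis using F False lev by (simp add: benefit_def)
    qed
    then show ?thesis using False \<epsilon> by (simp add: field_simps)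
  qed
  have "(\<Sum>v\<in>top_unmarked m. ?w v) \<le>
      (\<Sum>v\<in>top_unmarked m. 2 / \<epsilon> * benefit v + (if v \<in> crowded \<epsilon> then ?w v else 0))"
    by (rule sum_mono) (rule 1)
  also have "\<dots> = 2 / \<epsilon> * (\<Sum>v\<in>top_unmarked m. benefit v) + (\<Sum>v\<in>top_unmarked m \<inter> crowded \<epsilon>. ?w v)"
    using finU by (simp add: sum.distrib sum_distrib_left sum.inter_restrict)
  also have "(\<Sum>v\<in>top_unmarked m \<inter> crowded \<epsilon>. ?w v) \<le> (\<Sum>v\<in>{v \<in> crowded \<epsilon>. \<not> m v}. ?w v)"
    using finH w0 by (intro sum_mono2) (auto elim: top_unmarkedE)
  finally show ?thesis by simp
qed

lemma superset_cost_marks: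
  assumes \<epsilon>: "0 < \<epsilon>" "\<epsilon> \<le> 1"
    and m: "\<And>v. v \<in> Vx \<Longrightarrow> f \<le> lam ^ level T v \<Longrightarrow> m v"
    and opt: "opt = ennreal z" "0 \<le> z"
  shows "superset_cost (leaves T) d f N (out_set T m) \<le>
    ennreal (2 * z + f * card {v \<in> bad \<epsilon>. m v} + 2 * lam / (lam - 1) *
      (2 / \<epsilon> * z + (\<Sum>v\<in>{v \<in> crowded \<epsilon>. \<not> m v}. real (cn v) * lam ^ level T v)))"
proof -
  have z: "(\<Sum>v\<in>A. benefit v) \<le> z" if "A \<subseteq> Vx" "disjoint_family_on below A" for A
    using antichain_opt[OF that] opt by simp
  have a: "f * card (minimal_sig \<epsilon> m) \<le> 2 * z"
    using minimal_sig_le[of \<epsilon> m] \<epsilon> z[OF minimal_sig_Vx minimal_sig_disjoint, of \<epsilon> m] by simp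
  have "2 / \<epsilon> * (\<Sum>v\<in>top_unmarked m. benefit v) \<le> 2 / \<epsilon> * z"
    using z[OF top_unmarked_Vx top_unmarked_disjoint, of m] \<epsilon> by (intro mult_left_mono) auto
  then have "(\<Sum>v\<in>top_unmarked m. real (cn v) * lam ^ level T v) \<le>
      2 / \<epsilon> * z + (\<Sum>v\<in>{v \<in> crowded \<epsilon>. \<not> m v}. real (cn v) * lam ^ level T v)"
    using top_unmarked_le[of \<epsilon> m, OF \<epsilon> m] by linarith
  then have "2 * lam / (lam - 1) * (\<Sum>v\<in>top_unmarked m. real (cn v) * lam ^ level T v) \<le>
      2 * lam / (lam - 1) *
      (2 / \<epsilon> * z + (\<Sum>v\<in>{v \<in> crowded \<epsilon>. \<not> m v}. real (cn v) * lam ^ level T v))"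
    using lam by (intro mult_left_mono) auto
  then show ?thesis
    using superset_cost_le[of \<epsilon> m] connection_le[of m] a \<epsilon>
    by (intro order_trans[OF superset_cost_le[of \<epsilon> m]] ennreal_leI) auto
qed

end

section \<open>Random marks\<close>

text \<open>The square root of \<open>w / f\<close>, written with the operations \<open>RExp\<close>
  and \<open>RLn\<close> that a program has. This form is positive for all arguments.\<close>

definition root_ratio :: "real \<Rightarrow> real \<Rightarrow> real" where
  "root_ratio f w = exp (ln (w / f) / 2)"

definition bias :: "nat \<Rightarrow> real \<Rightarrow> real \<Rightarrow> real \<Rightarrow> nat \<Rightarrow> real" where
  "bias M f \<epsilon> w c =
     (if w < f then 1 / (1 + exp (- ((\<epsilon> * root_ratio f w * real c - 1 / root_ratio f w) / real M)))
      else 1)"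

lemma root_ratio_pos: "0 < root_ratio f w"
  by (simp add: root_ratio_def)

lemma root_ratio_sqrt:
  assumes "0 < w" "0 < f" shows "root_ratio f w = sqrt w / sqrt f"
  using assms by (simp add: root_ratio_def ln_sqrt[symmetric] exp_ln flip: real_sqrt_divide)

lemma root_ratio_square:
  assumes "0 < w" "0 < f" shows "f * root_ratio f w ^ 2 = w"
  using assms by (simp add: root_ratio_sqrt power_divide)

text \<open>The terms grow by the factor \<open>sqrt lam\<close>, and the last is at most 1 because
  its level satisfies \<open>lam ^ k < f\<close>. Read downward they form a geometric series with a
  bound independent of \<open>K\<close> and \<open>f\<close>.\<close>

lemma sum_root_ratio_le:
  fixes lam f :: real
  assumes lam: "1 < lam"
  shows "(\<Sum>k\<in>{k. k \<le> K \<and> lam ^ k < f}. root_ratio f (lam ^ k)) \<le> sqrt lam / (sqrt lam - 1)"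
proof (cases "{k. k \<le> K \<and> lam ^ k < f} = {}")
  case True
  then show ?thesis using lam by (simp only: sum.empty) simp
next
  case False
  let ?A = "{k. k \<le> K \<and> lam ^ k < f}"
  have fin: "finite ?A" by simp
  define k0 where "k0 = Max ?A"
  have k0: "k0 \<in> ?A" unfolding k0_def using Max_in[OF fin False] .
  have sub: "?A \<subseteq> {..<Suc k0}" using Max_ge[OF fin] by (auto simp: k0_def less_Suc_eq_le)
  have f0: "0 < f"
  proof -
    have "0 < lam ^ k0" using lam by simp
    then show ?thesis using k0 by simp
  qed
  define r where "r = sqrt lam"
  have r: "1 < r" using lam by (simp add: r_def)
  have rr: "root_ratio f (lam ^ k) = r ^ k / sqrt f" for k
    using lam f0 by (simp add: root_ratio_sqrt real_sqrt_power r_def)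
  have "(\<Sum>k\<in>?A. root_ratio f (lam ^ k)) \<le> (\<Sum>k<Suc k0. root_ratio f (lam ^ k))"
    using sub by (intro sum_mono2) (auto intro: less_imp_le[OF root_ratio_pos])
  also have "\<dots> = (r ^ Suc k0 - 1) / (r - 1) / sqrt f"
    using r by (simp only: rr sum_divide_distrib[symmetric]) (subst geometric_sum, auto)
  also have "\<dots> \<le> r ^ Suc k0 / (r - 1) / sqrt f"
    using r f0 by (intro divide_right_mono) auto
  also have "\<dots> = r / (r - 1) * (r ^ k0 / sqrt f)"
    by simp
  also have "\<dots> \<le> r / (r - 1) * 1"
  proof (rule mult_left_mono)
    have "r ^ k0 \<le> sqrt f"
      using k0 by (simp add: r_def flip: real_sqrt_power)
    then show "r ^ k0 / sqrt f \<le> 1" using f0 by simp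
  qed (use r in simp)
  finally show ?thesis by (simp add: r_def)
qed

section \<open>The logistic function and the privacy of a single coin\<close>

lemma sigmoid_ratio:
  fixes s t e :: real
  assumes "\<bar>s - t\<bar> \<le> e"
  shows "1 / (1 + exp (- s)) \<le> exp e * (1 / (1 + exp (- t)))"
proof -
  have "exp (- t) \<le> exp e * exp (- s)" using assms by (simp flip: exp_add)
  moreover have "1 \<le> exp e" using assms by simp
  ultimately have "1 + exp (- t) \<le> exp e * (1 + exp (- s))" by (simp add: distrib_left add_mono)
  then show ?thesis
    using exp_gt_zero[of "- s"] exp_gt_zero[of "- t"] by (simp add: field_simps add_pos_pos)
qed

lemma sigmoid_compl: "1 - 1 / (1 + exp (- s)) = 1 / (1 + exp (- (- s :: real)))"
proof -
  have "1 - 1 / (1 + inverse a) = 1 / (1 + a)" if "0 < a" for a :: real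
    using that by (simp add: divide_simps)
  from this[of "exp s"] show ?thesis by (simp add: exp_minus)
qed

lemma sigmoid_le_exp: "1 / (1 + exp (- s)) \<le> exp (s :: real)"
proof -
  have "exp s * exp (- s) = 1" by (simp add: exp_minus)
  then show ?thesis
    using exp_gt_zero[of s] exp_gt_zero[of "- s"] by (simp add: field_simps add_pos_pos)
qed

lemma bias_bounds: "0 \<le> bias M f \<epsilon> w c" "bias M f \<epsilon> w c \<le> 1"
  by (auto simp: bias_def field_simps add_pos_pos)

lemma bias_ratio:
  fixes c c' :: nat
  assumes "\<bar>int c - int c'\<bar> \<le> 1" "0 \<le> \<epsilon>"
  shows "pmf (bernoulli_pmf (bias M f \<epsilon> w c)) y \<le>
    exp (if w < f then \<epsilon> * root_ratio f w / real M else 0) * pmf (bernoulli_pmf (bias M f \<epsilon> w c')) y"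
proof (cases "w < f")
  case True
  define s where "s x = (\<epsilon> * root_ratio f w * real x - 1 / root_ratio f w) / real M" for x
  have "\<bar>real c - real c'\<bar> \<le> 1" using assms(1) by linarith
  then have "(\<epsilon> * root_ratio f w / real M) * \<bar>real c - real c'\<bar> \<le> (\<epsilon> * root_ratio f w / real M) * 1"
    using assms(2) root_ratio_pos[of f w] by (intro mult_left_mono) auto
  moreover have "\<bar>s c - s c'\<bar> = (\<epsilon> * root_ratio f w / real M) * \<bar>real c - real c'\<bar>"
  proof -
    have "s c - s c' = (\<epsilon> * root_ratio f w / real M) * (real c - real c')"
      by (simp add: s_def diff_divide_distrib right_diff_distrib)
    then show ?thesis using assms(2) root_ratio_pos[of f w] by (simp add: abs_mult)
  qed
  ultimately have le: "\<bar>s c - s c'\<bar> \<le> \<epsilon> * root_ratio f w / real M" by simp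
  have b: "bias M f \<epsilon> w x = 1 / (1 + exp (- s x))" for x using True by (simp add: bias_def s_def)
  have "\<bar>- s c - - s c'\<bar> \<le> \<epsilon> * root_ratio f w / real M" using le by simp
  then have "1 - bias M f \<epsilon> w c \<le> exp (\<epsilon> * root_ratio f w / real M) * (1 - bias M f \<epsilon> w c')"
    unfolding b sigmoid_compl by (rule sigmoid_ratio)
  moreover have "bias M f \<epsilon> w c \<le> exp (\<epsilon> * root_ratio f w / real M) * bias M f \<epsilon> w c'"
    unfolding b by (rule sigmoid_ratio[OF le])
  ultimately show ?thesis
    using True bias_bounds by (cases y) auto
qed (simp add: bias_def)

section \<open>The joint distribution of the marks and its privacy\<close>

primrec cnt :: "rtree \<Rightarrow> (nat \<Rightarrow> nat) \<Rightarrow> nat \<Rightarrow> nat \<Rightarrow> nat" where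
  "cnt T N 0 v = 0"
| "cnt T N (Suc i) v =
     (if i \<in> leaves T \<and> (\<exists>k\<le>height T. anc T k i = v) then cnt T N i v + N i else cnt T N i v)"

text \<open>Like \<open>cnt\<close>, a recursion over the outer loop of \<open>count_all\<close>:
  the content of an array after the first \<open>i\<close> vertices. A vertex above no leaf would
  keep the initial value 0.\<close>

primrec weight :: "real \<Rightarrow> rtree \<Rightarrow> nat \<Rightarrow> nat \<Rightarrow> real" where
  "weight lam T 0 v = 0"
| "weight lam T (Suc i) v =
     (if i \<in> leaves T \<and> (\<exists>k\<le>height T. anc T k i = v) then lam ^ level T v else weight lam T i v)"

definition marks_pmf :: "nat \<Rightarrow> real \<Rightarrow> rtree \<Rightarrow> real \<Rightarrow> real \<Rightarrow> (nat \<Rightarrow> nat) \<Rightarrow> (nat \<Rightarrow> bool) pmf" where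
  "marks_pmf M lam T f \<epsilon> N = Pi_pmf {..<vnum T} False
     (\<lambda>v. bernoulli_pmf (bias M f \<epsilon> (weight lam T (vnum T) v) (cnt T N (vnum T) v)))"

lemma cnt_sum:
  "cnt T N i v = (\<Sum>u\<in>{u \<in> leaves T. u < i \<and> (\<exists>k\<le>height T. anc T k u = v)}. N u)"
proof (induction i)
  case 0
  then show ?case by simp
next
  case (Suc i)
  let ?A = "\<lambda>i. {u \<in> leaves T. u < i \<and> (\<exists>k\<le>height T. anc T k u = v)}"
  have "?A (Suc i) = (if i \<in> leaves T \<and> (\<exists>k\<le>height T. anc T k i = v) then insert i (?A i) else ?A i)"
    by (auto simp: less_Suc_eq)
  moreover have "finite (?A i)" by simp
  ultimately show ?case using Suc by auto
qed

text \<open>Reduces privacy to single outcomes.\<close>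

lemma measure_pmf_le_of_pmf_le:
  assumes le: "\<And>x. pmf p x \<le> c * pmf q x" and c: "0 \<le> c"
  shows "measure_pmf.prob p E \<le> c * measure_pmf.prob q E"
proof -
  have "emeasure p E = (\<integral>\<^sup>+x. ennreal (pmf p x) \<partial>count_space E)"
    by (simp add: nn_integral_pmf)
  also have "\<dots> \<le> (\<integral>\<^sup>+x. ennreal c * ennreal (pmf q x) \<partial>count_space E)"
    using le c by (intro nn_integral_mono) (simp add: ennreal_leI flip: ennreal_mult)
  also have "\<dots> = ennreal c * emeasure q E"
    by (simp add: nn_integral_cmult nn_integral_pmf)
  finally show ?thesis
    using c by (simp add: measure_pmf.emeasure_eq_measure flip: ennreal_mult)
qed

text \<open>Composition for independent coins: the privacy losses add up.\<close>

lemma Pi_pmf_ratio: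
  assumes A: "finite A" and le: "\<And>v y. v \<in> A \<Longrightarrow> pmf (p v) y \<le> exp (e v) * pmf (q v) y"
  shows "pmf (Pi_pmf A D p) x \<le> exp (sum e A) * pmf (Pi_pmf A D q) x"
proof -
  have "(\<Prod>v\<in>A. pmf (p v) (x v)) \<le> (\<Prod>v\<in>A. exp (e v) * pmf (q v) (x v))"
    by (rule prod_mono) (use le in auto)
  then show ?thesis
    by (auto simp: pmf_Pi[OF A] exp_sum[OF A] prod.distrib intro!: mult_nonneg_nonneg prod_nonneg)
qed

context hst
begin

lemma weight_anc:
  assumes "u \<in> leaves T" "k \<le> L" shows "weight lam T n (anc T k u) = lam ^ k"
proof -
  have "weight lam T i v = lam ^ level T v" if "u < i" "\<exists>k\<le>L. anc T k u = v" for i v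
    using that assms(1) by (induction i) (auto simp: less_Suc_eq)
  from this[of n "anc T k u"] show ?thesis using assms level_anc leaf_lt by auto
qed

text \<open>One client more or less at \<open>u\<close> affects only the coins of the ancestors of
  \<open>u\<close>, one per level, so the losses sum to \<epsilon> / M times a sum of root ratios.
  The function \<open>g\<close> is post-processing.\<close>

lemma marks_pmf_private:
  assumes \<epsilon>: "0 \<le> \<epsilon>" and M: "sqrt lam / (sqrt lam - 1) \<le> real M"
  shows "differentially_private \<epsilon> (leaves T) (\<lambda>N. map_pmf g (marks_pmf M lam T f \<epsilon> N))"
  unfolding differentially_private_def
proof (intro allI impI)
  fix N N' :: "nat \<Rightarrow> nat" and E
  assume *: "(\<Sum>v\<in>leaves T. \<bar>int (N v) - int (N' v)\<bar>) = 1"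
  \<comment> \<open>A sum of natural numbers that equals 1 has exactly one nonzero term: the inputs
    differ at a single leaf.\<close>
  then have "int (\<Sum>v\<in>leaves T. nat \<bar>int (N v) - int (N' v)\<bar>) = 1" by simp
  then have "(\<Sum>v\<in>leaves T. nat \<bar>int (N v) - int (N' v)\<bar>) = 1" by presburger
  then have "\<exists>u\<in>leaves T. nat \<bar>int (N u) - int (N' u)\<bar> = 1 \<and>
      (\<forall>v\<in>leaves T. v \<noteq> u \<longrightarrow> nat \<bar>int (N v) - int (N' v)\<bar> = 0)"
    using finite_leaves by (subst (asm) sum_eq_1_iff) auto
  then obtain u where u: "u \<in> leaves T" and same: "\<And>v. v \<in> leaves T \<Longrightarrow> v \<noteq> u \<Longrightarrow> N v = N' v"
    by fastforce
  \<comment> \<open>The loss of each coin. Vertices of weight at least \<open>f\<close> are marked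
    with certainty and lose nothing.\<close>
  define e where "e v = (if (\<exists>k\<le>L. anc T k u = v) \<and> weight lam T n v < f
      then \<epsilon> * root_ratio f (weight lam T n v) / real M else 0)" for v
  let ?b = "\<lambda>N v. bernoulli_pmf (bias M f \<epsilon> (weight lam T n v) (cnt T N n v))"
  have ratio: "pmf (?b N v) y \<le> exp (e v) * pmf (?b N' v) y" for v y
  proof (cases "\<exists>k\<le>L. anc T k u = v")
    case True
    let ?A = "{x \<in> leaves T. x < n \<and> (\<exists>k\<le>L. anc T k x = v)}"
    have "\<bar>int (cnt T N n v) - int (cnt T N' n v)\<bar> = \<bar>\<Sum>x\<in>?A. int (N x) - int (N' x)\<bar>"
      by (simp add: cnt_sum sum_subtractf)
    also have "\<dots> \<le> (\<Sum>x\<in>?A. \<bar>int (N x) - int (N' x)\<bar>)" by (rule sum_abs)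
    also have "\<dots> \<le> (\<Sum>x\<in>leaves T. \<bar>int (N x) - int (N' x)\<bar>)"
      by (rule sum_mono2) (auto simp: finite_leaves)
    finally have "\<bar>int (cnt T N n v) - int (cnt T N' n v)\<bar> \<le> 1" using * by simp
    from bias_ratio[OF this \<epsilon>] True show ?thesis by (simp add: e_def)
  next
    case False
    then have "cnt T N n v = cnt T N' n v"
      unfolding cnt_sum by (intro sum.cong refl same) auto
    then show ?thesis using False by (auto simp: e_def)
  qed
  let ?K = "{k. k \<le> L \<and> lam ^ k < f}"
  have "sum e {..<n} = (\<Sum>v\<in>(\<lambda>k. anc T k u) ` ?K. e v)"
    by (rule sum.mono_neutral_right)
      (use anc_lt leaf_lt u in \<open>auto simp: e_def weight_anc\<close>)
  also have "\<dots> = (\<Sum>k\<in>?K. e (anc T k u))"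
    by (rule sum.reindex_cong[OF _ refl refl]) (use anc_eq_level[OF u u] in \<open>auto simp: inj_on_def\<close>)
  also have "\<dots> = (\<Sum>k\<in>?K. \<epsilon> / real M * root_ratio f (lam ^ k))"
    by (rule sum.cong) (auto simp: e_def weight_anc u)
  also have "\<dots> \<le> \<epsilon> / real M * real M"
    unfolding sum_distrib_left[symmetric]
    using order_trans[OF sum_root_ratio_le[OF lam] M] \<epsilon> by (intro mult_left_mono) auto
  also have "\<dots> \<le> \<epsilon>" using \<epsilon> by simp
  finally have sum: "sum e {..<n} \<le> \<epsilon>" .
  have "pmf (marks_pmf M lam T f \<epsilon> N) x \<le> exp \<epsilon> * pmf (marks_pmf M lam T f \<epsilon> N') x" for x
  proof -
    have "pmf (marks_pmf M lam T f \<epsilon> N) x \<le> exp (sum e {..<n}) * pmf (marks_pmf M lam T f \<epsilon> N') x"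
      unfolding marks_pmf_def by (rule Pi_pmf_ratio) (use ratio in auto)
    also have "\<dots> \<le> exp \<epsilon> * pmf (marks_pmf M lam T f \<epsilon> N') x"
      using sum by (intro mult_right_mono) auto
    finally show ?thesis .
  qed
  then show "measure_pmf.prob (map_pmf g (marks_pmf M lam T f \<epsilon> N)) E \<le>
      exp \<epsilon> * measure_pmf.prob (map_pmf g (marks_pmf M lam T f \<epsilon> N')) E"
    by (simp add: measure_pmf_le_of_pmf_le)
qed

end

section \<open>Expected cost of the mistakes\<close>

context hst_ufl
begin

lemma Vx_lt: "v \<in> Vx \<Longrightarrow> v < n"
  by (auto simp: Vx_def anc_lt leaf_lt)

lemma weight_Vx: "v \<in> Vx \<Longrightarrow> weight lam T n v = lam ^ level T v"
  by (auto simp: Vx_def weight_anc level_anc)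

lemma cnt_Vx:
  assumes "v \<in> Vx" shows "cnt T N n v = cn v"
proof -
  obtain k u where v: "v = anc T k u" "k \<le> L" "u \<in> leaves T" using assms by (auto simp: Vx_def)
  have "(\<exists>j\<le>L. anc T j x = v) \<longleftrightarrow> anc T k x = v" if "x \<in> leaves T" for x
    using anc_eq_level[OF that v(3) _ v(2)] v by blast
  then show ?thesis
    unfolding cnt_sum cn_def using v by (intro sum.cong) (auto simp: below_anc leaf_lt)
qed

text \<open>The vertices of one level form an antichain, so their benefits sum to at most the
  optimum. The root ratio depends only on the level, and its sum over the levels is at most
  \<open>M\<close>.\<close>

lemma sum_root_ratio_benefit:
  assumes M: "sqrt lam / (sqrt lam - 1) \<le> real M" and opt: "opt = ennreal z" "0 \<le> z"
    and A: "A \<subseteq> {v \<in> Vx. lam ^ level T v < f}"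
  shows "(\<Sum>v\<in>A. root_ratio f (lam ^ level T v) * benefit v) \<le> M * z"
proof -
  let ?V = "{v \<in> Vx. lam ^ level T v < f}" and ?K = "{k. k \<le> L \<and> lam ^ k < f}"
  have "(\<Sum>v\<in>A. root_ratio f (lam ^ level T v) * benefit v) \<le>
      (\<Sum>v\<in>?V. root_ratio f (lam ^ level T v) * benefit v)"
    using finite_Vx A benefit_nonneg root_ratio_pos
    by (intro sum_mono2) (auto intro!: mult_nonneg_nonneg less_imp_le[OF root_ratio_pos])
  also have "\<dots> = (\<Sum>k\<in>?K. \<Sum>v\<in>{v \<in> ?V. level T v = k}. root_ratio f (lam ^ level T v) * benefit v)"
    by (rule sum.group[symmetric]) (use finite_Vx level_le in auto)
  also have "\<dots> = (\<Sum>k\<in>?K. root_ratio f (lam ^ k) * (\<Sum>v\<in>{v \<in> ?V. level T v = k}. benefit v))"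
    by (simp add: sum_distrib_left)
  also have "\<dots> \<le> (\<Sum>k\<in>?K. root_ratio f (lam ^ k) * z)"
  proof (intro sum_mono mult_left_mono less_imp_le[OF root_ratio_pos])
    fix k assume "k \<in> ?K"
    have "disjoint_family_on below {v \<in> ?V. level T v = k}"
      by (auto simp: disjoint_family_on_def below_def)
    then show "(\<Sum>v\<in>{v \<in> ?V. level T v = k}. benefit v) \<le> z"
      using antichain_opt[of "{v \<in> ?V. level T v = k}"] opt by auto
  qed
  also have "\<dots> \<le> M * z"
    unfolding sum_distrib_right[symmetric]
    using order_trans[OF sum_root_ratio_le[OF lam] M] opt by (intro mult_right_mono) auto
  finally show ?thesis .
qed

text \<open>The exponent is at most \<open>- y\<close> for \<open>y = 1 / (2 * q * M)\<close>. A
  cubic estimate is the right one: two of the three factors \<open>q\<close> turn \<open>f\<close>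
  into the edge weight \<open>w\<close>, which one client already makes a lower bound for the
  benefit, and the third is left for the sum over levels. The constant is 216 = 27 * 8, from
  \<open>exp (- y) \<le> 27 / y ^ 3\<close>.\<close>

lemma bad_bias:
  assumes \<epsilon>: "0 < \<epsilon>" and M: "0 < M" and v: "v \<in> bad \<epsilon>"
  shows "f * bias M f \<epsilon> (lam ^ level T v) (cn v) \<le>
    216 * real M ^ 3 * (root_ratio f (lam ^ level T v) * benefit v)"
proof -
  define w where "w = lam ^ level T v"
  define q where "q = root_ratio f w"
  have vv: "level T v < L" "w < f" "\<epsilon> * real (cn v) * w < f / 2" "0 < cn v"
    using v level_le[of v] by (auto simp: bad_def sig_def w_def)
  have w: "0 < w" using lam by (simp add: w_def)
  have f0: "0 < f" using w vv by simp
  have q: "0 < q" by (simp add: q_def root_ratio_pos)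
  have fq: "f * q ^ 2 = w" unfolding q_def by (rule root_ratio_square[OF w f0])
  define y where "y = 1 / (2 * q * real M)"
  have y: "0 < y" using q M by (simp add: y_def)
  have "f * (\<epsilon> * real (cn v) * q ^ 2) < f * (1 / 2)" using vv(3) by (simp add: fq[symmetric] algebra_simps)
  then have "\<epsilon> * real (cn v) * q ^ 2 < 1 / 2" using f0 by (simp only: mult_less_cancel_left_pos)
  then have "\<epsilon> * q * real (cn v) \<le> 1 / (2 * q)"
    using q by (simp add: field_simps power2_eq_square)
  then have "\<epsilon> * q * real (cn v) - 1 / q \<le> - 1 / (2 * q)"
    using q by (simp add: field_simps)
  then have "(\<epsilon> * q * real (cn v) - 1 / q) / real M \<le> (- 1 / (2 * q)) / real M"
    using M by (intro divide_right_mono) auto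
  also have "\<dots> = - y" by (simp add: y_def)
  finally have "exp ((\<epsilon> * q * real (cn v) - 1 / q) / real M) \<le> exp (- y)" by simp
  moreover have "bias M f \<epsilon> w (cn v) \<le> exp ((\<epsilon> * q * real (cn v) - 1 / q) / real M)"
    using vv(2) sigmoid_le_exp[of "(\<epsilon> * q * real (cn v) - 1 / q) / real M"]
    by (simp add: bias_def q_def)
  moreover have "exp (- y) \<le> 27 / y ^ 3"
  proof -
    have "y / 3 \<le> exp (y / 3)" using exp_ge_add_one_self[of "y / 3"] by linarith
    then have "(y / 3) ^ 3 \<le> exp (y / 3) ^ 3" using y by (intro power_mono) auto
    also have "exp (y / 3) ^ 3 = exp y" by (simp flip: exp_of_nat_mult)
    finally show ?thesis using y by (simp add: exp_minus field_simps)
  qed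
  moreover have "27 / y ^ 3 = 216 * real M ^ 3 * q ^ 3"
    using q M by (simp add: y_def field_simps power3_eq_cube)
  ultimately have "bias M f \<epsilon> w (cn v) \<le> 216 * real M ^ 3 * q ^ 3" by linarith
  then have "f * bias M f \<epsilon> w (cn v) \<le> f * (216 * real M ^ 3 * q ^ 3)"
    using f by (rule mult_left_mono)
  also have "\<dots> = 216 * real M ^ 3 * (q * w)"
    by (simp add: fq[symmetric] power3_eq_cube power2_eq_square)
  also have "\<dots> \<le> 216 * real M ^ 3 * (q * benefit v)"
  proof (intro mult_left_mono)
    have "w \<le> real (cn v) * w" using vv w by simp
    then show "w \<le> benefit v" using vv by (simp add: benefit_def w_def)
  qed (use q in auto)
  finally show ?thesis by (simp add: q_def w_def)
qed

text \<open>Here \<open>1 / y\<close> suffices as a bound for \<open>exp (- y)\<close>: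
  \<open>y\<close> is proportional to the number of clients, which cancels against the number of
  clients that are connected badly. What remains is a multiple of \<open>q * f\<close>, and
  \<epsilon> \<le> 1 makes the benefit equal to \<open>f\<close>.\<close>

lemma crowded_bias:
  assumes \<epsilon>: "0 < \<epsilon>" "\<epsilon> \<le> 1" and M: "0 < M" and v: "v \<in> crowded \<epsilon>"
  shows "real (cn v) * lam ^ level T v * (1 - bias M f \<epsilon> (lam ^ level T v) (cn v)) \<le>
    2 * real M / \<epsilon> * (root_ratio f (lam ^ level T v) * benefit v)"
proof -
  define w where "w = lam ^ level T v"
  define q where "q = root_ratio f w"
  have vv: "level T v < L" "w < f" "2 * f < \<epsilon> * real (cn v) * w"
    using v by (auto simp: crowded_def w_def)
  have w: "0 < w" using lam by (simp add: w_def)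
  have f0: "0 < f" using w vv by simp
  have q: "0 < q" by (simp add: q_def root_ratio_pos)
  have fq: "f * q ^ 2 = w" unfolding q_def by (rule root_ratio_square[OF w f0])
  have c: "0 < cn v" using vv f0 by (cases "cn v = 0") auto
  define y where "y = \<epsilon> * real (cn v) * q / (2 * real M)"
  have y: "0 < y" using q M c \<epsilon> by (simp add: y_def)
  have "f * 2 < f * (\<epsilon> * real (cn v) * q ^ 2)" using vv(3) by (simp add: fq[symmetric] algebra_simps)
  then have "2 < \<epsilon> * real (cn v) * q ^ 2" using f0 by (simp only: mult_less_cancel_left_pos)
  then have "1 / q \<le> \<epsilon> * q * real (cn v) / 2"
    using q by (simp add: field_simps power2_eq_square)
  then have "\<epsilon> * q * real (cn v) / 2 / real M \<le> (\<epsilon> * q * real (cn v) - 1 / q) / real M"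
    using M by (intro divide_right_mono) auto
  then have "exp (- ((\<epsilon> * q * real (cn v) - 1 / q) / real M)) \<le> exp (- y)"
    by (simp add: y_def mult_ac)
  moreover have "1 - bias M f \<epsilon> w (cn v) \<le> exp (- ((\<epsilon> * q * real (cn v) - 1 / q) / real M))"
    using vv(2) sigmoid_le_exp[of "- ((\<epsilon> * q * real (cn v) - 1 / q) / real M)"]
    by (simp add: bias_def q_def sigmoid_compl del: minus_divide_left)
  moreover have "exp (- y) \<le> 1 / y"
  proof -
    have "y \<le> exp y" using exp_ge_add_one_self[of y] by linarith
    then show ?thesis using y by (simp add: exp_minus field_simps)
  qed
  ultimately have "1 - bias M f \<epsilon> w (cn v) \<le> 1 / y" by linarith
  then have "real (cn v) * w * (1 - bias M f \<epsilon> w (cn v)) \<le> real (cn v) * w * (1 / y)"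
    using w by (intro mult_left_mono) auto
  also have "\<dots> = 2 * real M / \<epsilon> * (q * f)"
    using q M c \<epsilon> by (simp add: y_def fq[symmetric] field_simps power2_eq_square)
  also have "\<dots> = 2 * real M / \<epsilon> * (q * benefit v)"
  proof -
    have "\<epsilon> * (real (cn v) * w) \<le> 1 * (real (cn v) * w)"
      using \<epsilon> w by (intro mult_right_mono) auto
    then have "f \<le> real (cn v) * w" using vv f0 by (simp add: mult.assoc)
    then have "benefit v = f" using vv c by (simp add: benefit_def w_def)
    then show ?thesis by simp
  qed
  finally show ?thesis by (simp add: q_def w_def)
qed

text \<open>In the constant, 2 stands for the minimal significant vertices,
  \<open>216 * M ^ 4\<close> for wrong marks, and the last summand for the connections, whose part
  \<open>2 * M ^ 2\<close> is due to missing marks. A factor \<open>M\<close> in each of the last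
  two terms comes from the sum over levels.\<close>

lemma expected_cost_le:
  assumes \<epsilon>: "0 < \<epsilon>" "\<epsilon> \<le> 1" and M: "sqrt lam / (sqrt lam - 1) \<le> real M"
    and ne: "leaves T \<noteq> {}"
  shows "(\<integral>\<^sup>+ m. superset_cost (leaves T) d f N (out_set T m) \<partial>measure_pmf (marks_pmf M lam T f \<epsilon> N)) \<le>
    ennreal ((2 + 216 * real M ^ 4 + 2 * lam / (lam - 1) * (2 + 2 * real M ^ 2)) / \<epsilon>) * opt"
proof -
  have M0: "0 < M"
  proof -
    have "0 < sqrt lam / (sqrt lam - 1)" using lam by simp
    then show ?thesis using M by (cases "M = 0") auto
  qed
  define z where "z = enn2real opt"
  have z: "opt = ennreal z" "0 \<le> z"
    using opt_finite[OF ne] by (auto simp: z_def)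
  define b where "b v = bias M f \<epsilon> (weight lam T n v) (cnt T N n v)" for v
  define w where "w v = real (cn v) * lam ^ level T v" for v
  define c where "c = 2 * lam / (lam - 1)"
  have c: "0 \<le> c" using lam by (simp add: c_def)
  have w0: "0 \<le> w v" for v using lam by (simp add: w_def)
  have b01: "0 \<le> b v" "b v \<le> 1" for v using bias_bounds by (auto simp: b_def)
  have fin: "finite (bad \<epsilon>)" "finite (crowded \<epsilon>)"
    using finite_Vx by (auto simp: bad_def crowded_def)
  have sub: "bad \<epsilon> \<subseteq> {v \<in> Vx. lam ^ level T v < f}" "crowded \<epsilon> \<subseteq> {v \<in> Vx. lam ^ level T v < f}"
    by (auto simp: bad_def sig_def crowded_def)
  let ?P = "marks_pmf M lam T f \<epsilon> N"
  have marg: "map_pmf (\<lambda>m. m v) ?P = bernoulli_pmf (b v)" if "v \<in> Vx" for v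
    unfolding marks_pmf_def b_def using Vx_lt[OF that] by (simp add: Pi_pmf_component)
  have em: "emeasure ?P {m. m v = y} = pmf (bernoulli_pmf (b v)) y" if "v \<in> Vx" for v y
  proof -
    have "emeasure ?P {m. m v = y} = emeasure (map_pmf (\<lambda>m. m v) ?P) {y}"
      by (simp add: vimage_def)
    then show ?thesis using marg[OF that] by (simp add: emeasure_pmf_single)
  qed
  have emT: "emeasure ?P {m. m v} = ennreal (b v)" if "v \<in> Vx" for v
    using em[OF that, of True] b01 by simp
  have emF: "emeasure ?P {m. \<not> m v} = ennreal (1 - b v)" if "v \<in> Vx" for v
    using em[OF that, of False] b01 by simp
  have always: "m v" if m: "m \<in> set_pmf ?P" and v: "v \<in> Vx" "f \<le> lam ^ level T v" for m v
  proof -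
    have "m v \<in> set_pmf (map_pmf (\<lambda>m. m v) ?P)" using m by auto
    then show ?thesis
      using v by (cases "m v") (auto simp: marg b_def weight_Vx bias_def set_pmf_iff)
  qed
  \<comment> \<open>The pointwise bound is linear in indicators of single marks, so its expectation
    involves only the marginal of each coin.\<close>
  have pt: "superset_cost (leaves T) d f N (out_set T m) \<le>
      ennreal (2 * z + c * (2 / \<epsilon> * z)) + (\<Sum>v\<in>bad \<epsilon>. ennreal f * indicator {m. m v = True} m) +
        (\<Sum>v\<in>crowded \<epsilon>. ennreal (c * w v) * indicator {m. m v = False} m)"
    if m: "m \<in> set_pmf ?P" for m
  proof -
    have 1: "(\<Sum>v\<in>bad \<epsilon>. ennreal f * indicator {m. m v = True} m) = ennreal (f * card {v \<in> bad \<epsilon>. m v})"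
    proof -
      have "(\<Sum>v\<in>bad \<epsilon>. ennreal f * indicator {m. m v = True} m) = (\<Sum>v\<in>bad \<epsilon>. ennreal (f * of_bool (m v)))"
        by (intro sum.cong) (auto simp: indicator_def)
      also have "\<dots> = ennreal (\<Sum>v\<in>bad \<epsilon>. f * of_bool (m v))"
        using f by (intro sum_ennreal) auto
      also have "(\<Sum>v\<in>bad \<epsilon>. f * of_bool (m v)) = f * card {v \<in> bad \<epsilon>. m v}"
        using fin by (simp add: sum_distrib_left[symmetric] Int_def)
      finally show ?thesis .
    qed
    have 2: "(\<Sum>v\<in>crowded \<epsilon>. ennreal (c * w v) * indicator {m. m v = False} m) =
        ennreal (c * (\<Sum>v\<in>{v \<in> crowded \<epsilon>. \<not> m v}. w v))"
    proof -
      have "(\<Sum>v\<in>crowded \<epsilon>. ennreal (c * w v) * indicator {m. m v = False} m) =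
          (\<Sum>v\<in>crowded \<epsilon>. ennreal (c * (if \<not> m v then w v else 0)))"
        by (intro sum.cong) (auto simp: indicator_def)
      also have "\<dots> = ennreal (\<Sum>v\<in>crowded \<epsilon>. c * (if \<not> m v then w v else 0))"
        using c w0 by (intro sum_ennreal) auto
      also have "(\<Sum>v\<in>crowded \<epsilon>. c * (if \<not> m v then w v else 0)) = c * (\<Sum>v\<in>{v \<in> crowded \<epsilon>. \<not> m v}. w v)"
        by (simp add: sum_distrib_left[symmetric] sum.inter_filter[OF fin(2)])
      finally show ?thesis .
    qed
    have "superset_cost (leaves T) d f N (out_set T m) \<le>
        ennreal (2 * z + f * card {v \<in> bad \<epsilon>. m v} +
          c * (2 / \<epsilon> * z + (\<Sum>v\<in>{v \<in> crowded \<epsilon>. \<not> m v}. w v)))"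
      unfolding c_def w_def by (rule superset_cost_marks[OF \<epsilon> always[OF m] z])
    also have "2 * z + f * card {v \<in> bad \<epsilon>. m v} + c * (2 / \<epsilon> * z + (\<Sum>v\<in>{v \<in> crowded \<epsilon>. \<not> m v}. w v)) =
        (2 * z + c * (2 / \<epsilon> * z)) + f * card {v \<in> bad \<epsilon>. m v} + c * (\<Sum>v\<in>{v \<in> crowded \<epsilon>. \<not> m v}. w v)"
      by (simp add: algebra_simps)
    also have "ennreal \<dots> = ennreal (2 * z + c * (2 / \<epsilon> * z)) + ennreal (f * card {v \<in> bad \<epsilon>. m v}) +
        ennreal (c * (\<Sum>v\<in>{v \<in> crowded \<epsilon>. \<not> m v}. w v))"
    proof -
      have "0 \<le> 2 * z + c * (2 / \<epsilon> * z)" "0 \<le> f * card {v \<in> bad \<epsilon>. m v}"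
          "0 \<le> c * (\<Sum>v\<in>{v \<in> crowded \<epsilon>. \<not> m v}. w v)"
        using z c \<epsilon> f w0 by (auto intro!: add_nonneg_nonneg mult_nonneg_nonneg sum_nonneg)
      then show ?thesis by (simp only: ennreal_plus add_nonneg_nonneg)
    qed
    finally show ?thesis unfolding 1 2 .
  qed
  have A: "(\<Sum>v\<in>bad \<epsilon>. f * b v) \<le> 216 * real M ^ 4 * z"
  proof -
    have "(\<Sum>v\<in>bad \<epsilon>. f * b v) \<le>
        (\<Sum>v\<in>bad \<epsilon>. 216 * real M ^ 3 * (root_ratio f (lam ^ level T v) * benefit v))"
      using bad_bias[OF \<epsilon>(1) M0] sub by (intro sum_mono) (auto simp: b_def weight_Vx cnt_Vx)
    also have "\<dots> \<le> 216 * real M ^ 3 * (M * z)"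
      unfolding sum_distrib_left[symmetric]
      by (intro mult_left_mono sum_root_ratio_benefit[OF M z sub(1)]) auto
    finally show ?thesis by (simp add: eval_nat_numeral mult_ac)
  qed
  have B: "(\<Sum>v\<in>crowded \<epsilon>. w v * (1 - b v)) \<le> 2 * real M ^ 2 / \<epsilon> * z"
  proof -
    have "(\<Sum>v\<in>crowded \<epsilon>. w v * (1 - b v)) \<le>
        (\<Sum>v\<in>crowded \<epsilon>. 2 * real M / \<epsilon> * (root_ratio f (lam ^ level T v) * benefit v))"
      using crowded_bias[OF \<epsilon> M0] sub by (intro sum_mono) (auto simp: b_def w_def weight_Vx cnt_Vx)
    also have "\<dots> \<le> 2 * real M / \<epsilon> * (M * z)"
      unfolding sum_distrib_left[symmetric] using \<epsilon>
      by (intro mult_left_mono sum_root_ratio_benefit[OF M z sub(2)]) auto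
    finally show ?thesis by (simp add: power2_eq_square mult_ac)
  qed
  have "(\<integral>\<^sup>+ m. superset_cost (leaves T) d f N (out_set T m) \<partial>?P) \<le>
      (\<integral>\<^sup>+ m. ennreal (2 * z + c * (2 / \<epsilon> * z)) + (\<Sum>v\<in>bad \<epsilon>. ennreal f * indicator {m. m v = True} m) +
        (\<Sum>v\<in>crowded \<epsilon>. ennreal (c * w v) * indicator {m. m v = False} m) \<partial>?P)"
    by (rule nn_integral_mono_AE) (use pt in \<open>auto simp: AE_measure_pmf_iff\<close>)
  also have "\<dots> = ennreal (2 * z + c * (2 / \<epsilon> * z)) + (\<Sum>v\<in>bad \<epsilon>. ennreal f * emeasure ?P {m. m v = True}) +
        (\<Sum>v\<in>crowded \<epsilon>. ennreal (c * w v) * emeasure ?P {m. m v = False})"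
    by (simp add: nn_integral_add nn_integral_sum nn_integral_cmult)
  also have "(\<Sum>v\<in>bad \<epsilon>. ennreal f * emeasure ?P {m. m v = True}) = (\<Sum>v\<in>bad \<epsilon>. ennreal (f * b v))"
    using sub(1) f b01 by (intro sum.cong refl) (simp add: emT subset_iff ennreal_mult)
  also have "(\<Sum>v\<in>crowded \<epsilon>. ennreal (c * w v) * emeasure ?P {m. m v = False}) =
      (\<Sum>v\<in>crowded \<epsilon>. ennreal (c * (w v * (1 - b v))))"
    using sub(2) c w0 b01
    by (intro sum.cong refl) (simp add: emF subset_iff ennreal_mult[symmetric] mult.assoc)
  also have "ennreal (2 * z + c * (2 / \<epsilon> * z)) + (\<Sum>v\<in>bad \<epsilon>. ennreal (f * b v)) +
      (\<Sum>v\<in>crowded \<epsilon>. ennreal (c * (w v * (1 - b v)))) =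
      ennreal ((2 * z + c * (2 / \<epsilon> * z)) + (\<Sum>v\<in>bad \<epsilon>. f * b v) + c * (\<Sum>v\<in>crowded \<epsilon>. w v * (1 - b v)))"
  proof -
    have "(\<Sum>v\<in>bad \<epsilon>. ennreal (f * b v)) = ennreal (\<Sum>v\<in>bad \<epsilon>. f * b v)"
      using f b01 by (intro sum_ennreal) auto
    moreover have "(\<Sum>v\<in>crowded \<epsilon>. ennreal (c * (w v * (1 - b v)))) = ennreal (c * (\<Sum>v\<in>crowded \<epsilon>. w v * (1 - b v)))"
      unfolding sum_distrib_left using c w0 b01 by (intro sum_ennreal) auto
    moreover have "0 \<le> 2 * z + c * (2 / \<epsilon> * z)" "0 \<le> (\<Sum>v\<in>bad \<epsilon>. f * b v)"
        "0 \<le> c * (\<Sum>v\<in>crowded \<epsilon>. w v * (1 - b v))"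
      using z c \<epsilon> f w0 b01 by (auto intro!: add_nonneg_nonneg mult_nonneg_nonneg sum_nonneg)
    ultimately show ?thesis by (simp only: ennreal_plus add_nonneg_nonneg)
  qed
  also have "\<dots> \<le> ennreal ((2 + 216 * real M ^ 4 + c * (2 + 2 * real M ^ 2)) / \<epsilon> * z)"
  proof (rule ennreal_leI)
    have "c * (\<Sum>v\<in>crowded \<epsilon>. w v * (1 - b v)) \<le> c * (2 * real M ^ 2 / \<epsilon> * z)"
      using B c by (rule mult_left_mono)
    moreover have "(2 + 216 * real M ^ 4) * z \<le> (2 + 216 * real M ^ 4) / \<epsilon> * z"
    proof (rule mult_right_mono)
      have "a \<le> a / \<epsilon>" if "0 \<le> a" for a
        using that \<epsilon> by (simp add: le_divide_eq mult_left_le)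
      then show "2 + 216 * real M ^ 4 \<le> (2 + 216 * real M ^ 4) / \<epsilon>" by simp
    qed (rule z)
    moreover have "(2 + 216 * real M ^ 4 + c * (2 + 2 * real M ^ 2)) / \<epsilon> * z =
        (2 + 216 * real M ^ 4) / \<epsilon> * z + c * (2 / \<epsilon> * z) + c * (2 * real M ^ 2 / \<epsilon> * z)"
      by (simp add: add_divide_distrib algebra_simps)
    ultimately show "2 * z + c * (2 / \<epsilon> * z) + (\<Sum>v\<in>bad \<epsilon>. f * b v) + c * (\<Sum>v\<in>crowded \<epsilon>. w v * (1 - b v)) \<le>
        (2 + 216 * real M ^ 4 + c * (2 + 2 * real M ^ 2)) / \<epsilon> * z"
      using A by (simp add: distrib_right)
  qed
  also have "\<dots> = ennreal ((2 + 216 * real M ^ 4 + c * (2 + 2 * real M ^ 2)) / \<epsilon>) * opt"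
    unfolding z(1) using z(2) \<epsilon> c
    by (intro ennreal_mult) (auto intro!: divide_nonneg_pos add_nonneg_nonneg mult_nonneg_nonneg)
  finally show ?thesis by (simp add: c_def)
qed

end

section \<open>The program\<close>

lemma nats_nstore [simp]:
  "nats (nstore a i k s) b j = (if b = a \<and> j = i then k else nats s b j)"
  by (simp add: nstore_def)

lemma reals_nstore [simp]: "reals (nstore a i k s) = reals s"
  by (simp add: nstore_def)

lemma reals_rstore [simp]:
  "reals (rstore a i x s) b j = (if b = a \<and> j = i then x else reals s b j)"
  by (simp add: rstore_def)

lemma nats_rstore [simp]: "nats (rstore a i x s) = nats s"
  by (simp add: rstore_def)

text \<open>The invariant may refer to the elapsed time, so one rule serves frames, running time and
  correctness.\<close>

lemma iterate_invariant:
  assumes "J 0 (s, 1)"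
    and "\<And>i s t s' t'. i < k \<Longrightarrow> J i (s, t) \<Longrightarrow> (s', t') \<in> set_pmf (b i s) \<Longrightarrow> J (Suc i) (s', t + t' + 1)"
  shows "\<forall>x\<in>set_pmf (iterate b k s). J k x"
  using assms
proof (induction k)
  case (Suc k)
  then have "\<forall>x\<in>set_pmf (iterate b k s). J k x" by simp
  then show ?case using Suc.prems(2)[of k] by fastforce
qed simp

primrec nwrites :: "com \<Rightarrow> nat set" where
  "nwrites (NStore a i e) = {a}"
| "nwrites (RStore a i e) = {}"
| "nwrites (Flip a i e) = {a}"
| "nwrites (Seq c c') = nwrites c \<union> nwrites c'"
| "nwrites (Cond b c c') = nwrites c \<union> nwrites c'"
| "nwrites (For x e c) = insert x (nwrites c)"

primrec rwrites :: "com \<Rightarrow> nat set" where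
  "rwrites (NStore a i e) = {}"
| "rwrites (RStore a i e) = {a}"
| "rwrites (Flip a i e) = {}"
| "rwrites (Seq c c') = rwrites c \<union> rwrites c'"
| "rwrites (Cond b c c') = rwrites c \<union> rwrites c'"
| "rwrites (For x e c) = rwrites c"

definition frame :: "com \<Rightarrow> memory \<Rightarrow> memory \<Rightarrow> bool" where
  "frame c s s' \<longleftrightarrow> (\<forall>a j. a \<notin> nwrites c \<longrightarrow> nats s' a j = nats s a j) \<and>
     (\<forall>a j. a \<notin> rwrites c \<longrightarrow> reals s' a j = reals s a j)"

lemma frame_refl: "frame c s s"
  by (simp add: frame_def)

lemma frame_trans: "frame c s s' \<Longrightarrow> frame c s' s'' \<Longrightarrow> frame c s s''"
  by (simp add: frame_def)

lemma frame_mono: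
  "frame c s s' \<Longrightarrow> nwrites c \<subseteq> nwrites c' \<Longrightarrow> rwrites c \<subseteq> rwrites c' \<Longrightarrow> frame c' s s'"
  unfolding frame_def by blast

lemma run_frame: "(s', t) \<in> set_pmf (run c s) \<Longrightarrow> frame c s s'"
proof (induction c arbitrary: s s' t)
  case (Seq c c')
  then obtain s1 t1 t2 where "(s1, t1) \<in> set_pmf (run c s)" "(s', t2) \<in> set_pmf (run c' s1)" by fastforce
  then have "frame c s s1" "frame c' s1 s'" using Seq.IH by blast+
  then have "frame (Seq c c') s s1" "frame (Seq c c') s1 s'" by (auto intro: frame_mono)
  then show ?case by (rule frame_trans)
next
  case (Cond b c c')
  then obtain t1 where "(s', t1) \<in> set_pmf (if tval b s then run c s else run c' s)" by fastforce
  then have "frame c s s' \<or> frame c' s s'" using Cond.IH by (auto split: if_splits)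
  then show ?case by (auto intro: frame_mono)
next
  case (For x e c)
  have "\<forall>y\<in>set_pmf (iterate (\<lambda>i s1. run c (nstore x 0 i s1)) (nval e s) s). frame (For x e c) s (fst y)"
  proof (rule iterate_invariant)
    fix i t1 t2 :: nat and s1 s2 :: memory
    assume 1: "frame (For x e c) s (fst (s1, t1))" and "(s2, t2) \<in> set_pmf (run c (nstore x 0 i s1))"
    then have "frame c (nstore x 0 i s1) s2" by (intro For.IH)
    then have "frame (For x e c) s1 s2" by (auto simp: frame_def)
    then show "frame (For x e c) s (fst (s2, t1 + t2 + 1))" using 1 frame_trans by auto
  qed (simp add: frame_refl)
  then show ?case using For.prems by fastforce
qed (auto simp: frame_def)

primrec bounded_loops :: "com \<Rightarrow> bool" where
  "bounded_loops (NStore a i e) = True"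
| "bounded_loops (RStore a i e) = True"
| "bounded_loops (Flip a i e) = True"
| "bounded_loops (Seq c c') = (bounded_loops c \<and> bounded_loops c')"
| "bounded_loops (Cond b c c') = (bounded_loops c \<and> bounded_loops c')"
| "bounded_loops (For x e c) = (bounded_loops c \<and>
     e \<in> {NLoad 0 (NConst 0), NLoad 0 (NConst 2), NAdd (NLoad 0 (NConst 2)) (NConst 1)})"

primrec time_poly :: "com \<Rightarrow> nat poly" where
  "time_poly (NStore a i e) = 1"
| "time_poly (RStore a i e) = 1"
| "time_poly (Flip a i e) = 1"
| "time_poly (Seq c c') = time_poly c + time_poly c'"
| "time_poly (Cond b c c') = time_poly c + time_poly c' + 1"
| "time_poly (For x e c) = 1 + [:0, 1:] * (time_poly c + 1)"

lemma run_time: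
  assumes "bounded_loops c" "0 \<notin> nwrites c" "nats s 0 0 = n" "nats s 0 2 < n"
    and "(s', t) \<in> set_pmf (run c s)"
  shows "t \<le> poly (time_poly c) n"
  using assms
proof (induction c arbitrary: s s' t)
  case (Seq c c')
  then obtain s1 t1 t2 where 1: "(s1, t1) \<in> set_pmf (run c s)" "(s', t2) \<in> set_pmf (run c' s1)" "t = t1 + t2"
    by fastforce
  then have "nats s1 0 0 = n" "nats s1 0 2 < n"
    using run_frame[OF 1(1)] Seq.prems by (auto simp: frame_def)
  then have "t1 \<le> poly (time_poly c) n" "t2 \<le> poly (time_poly c') n"
    using Seq.IH(1)[OF _ _ _ _ 1(1)] Seq.IH(2)[OF _ _ _ _ 1(2)] Seq.prems by auto
  then show ?case using 1 by simp
next
  case (Cond b c c')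
  then obtain t1 where 1: "(s', t1) \<in> set_pmf (if tval b s then run c s else run c' s)" "t = t1 + 1"
    by fastforce
  then show ?case
    using Cond.IH(1)[of s s' t1] Cond.IH(2)[of s s' t1] Cond.prems by (auto split: if_splits)
next
  case (For x e c)
  let ?B = "poly (time_poly c) n"
  let ?k = "nval e s"
  have "\<forall>y\<in>set_pmf (iterate (\<lambda>i s1. run c (nstore x 0 i s1)) ?k s).
      (nats (fst y) 0 0 = n \<and> nats (fst y) 0 2 < n) \<and> snd y \<le> 1 + ?k * (?B + 1)"
  proof (rule iterate_invariant[where J = "\<lambda>i y. (nats (fst y) 0 0 = n \<and> nats (fst y) 0 2 < n) \<and>
        snd y \<le> 1 + i * (?B + 1)"])
    fix i t1 t2 :: nat and s1 s2 :: memory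
    assume 1: "(nats (fst (s1, t1)) 0 0 = n \<and> nats (fst (s1, t1)) 0 2 < n) \<and> snd (s1, t1) \<le> 1 + i * (?B + 1)"
      and 2: "(s2, t2) \<in> set_pmf (run c (nstore x 0 i s1))"
    have "x \<noteq> 0" using For.prems by auto
    then have "t2 \<le> ?B" "nats s2 0 0 = n" "nats s2 0 2 < n"
      using For.IH[OF _ _ _ _ 2] run_frame[OF 2] For.prems 1 by (auto simp: frame_def)
    then show "(nats (fst (s2, t1 + t2 + 1)) 0 0 = n \<and> nats (fst (s2, t1 + t2 + 1)) 0 2 < n) \<and>
        snd (s2, t1 + t2 + 1) \<le> 1 + Suc i * (?B + 1)"
      using 1 by simp
  qed (use For.prems in auto)
  then have "t \<le> 1 + ?k * (?B + 1)" using For.prems by fastforce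
  moreover have "?k \<le> n" using For.prems by auto
  then have "?k * (?B + 1) \<le> n * (?B + 1)" by (rule mult_right_mono) simp
  ultimately show ?case by simp
qed auto

text \<open>A statement about all outcomes of the coins. It fixes a distribution only where the
  result is deterministic, by \<open>map_run_const\<close>; the coins themselves are treated by
  \<open>flip_marks_distribution\<close>.\<close>

definition wp :: "com \<Rightarrow> (memory \<Rightarrow> bool) \<Rightarrow> memory \<Rightarrow> bool" where
  "wp c Q s \<longleftrightarrow> (\<forall>x\<in>set_pmf (run c s). Q (fst x))"

lemma wp_NStore [simp]: "wp (NStore a i e) Q = (\<lambda>s. Q (nstore a (nval i s) (nval e s) s))"
  by (simp add: wp_def fun_eq_iff)

lemma wp_RStore [simp]: "wp (RStore a i e) Q = (\<lambda>s. Q (rstore a (nval i s) (rval e s) s))"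
  by (simp add: wp_def fun_eq_iff)

lemma wp_Seq [simp]: "wp (Seq c c') Q = wp c (wp c' Q)"
  by (fastforce simp: wp_def fun_eq_iff)

lemma wp_Cond [simp]: "wp (Cond b c c') Q = (\<lambda>s. if tval b s then wp c Q s else wp c' Q s)"
  by (auto simp: wp_def fun_eq_iff)

text \<open>The frame of the loop is available in each round and at the exit, so invariants can omit
  all arrays that the loop does not write.\<close>

lemma wp_For:
  assumes "I 0 s"
    and "\<And>i s'. i < nval e s \<Longrightarrow> I i s' \<Longrightarrow> frame (For x e c) s s' \<Longrightarrow> wp c (I (Suc i)) (nstore x 0 i s')"
    and "\<And>s'. I (nval e s) s' \<Longrightarrow> frame (For x e c) s s' \<Longrightarrow> Q s'"
  shows "wp (For x e c) Q s"
proof -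
  have "\<forall>y\<in>set_pmf (iterate (\<lambda>i s1. run c (nstore x 0 i s1)) (nval e s) s).
      I (nval e s) (fst y) \<and> frame (For x e c) s (fst y)"
  proof (rule iterate_invariant[where J = "\<lambda>i y. I i (fst y) \<and> frame (For x e c) s (fst y)"])
    fix i t1 t2 :: nat and s1 s2 :: memory
    assume 1: "i < nval e s" "I i (fst (s1, t1)) \<and> frame (For x e c) s (fst (s1, t1))"
      and 2: "(s2, t2) \<in> set_pmf (run c (nstore x 0 i s1))"
    have "frame c (nstore x 0 i s1) s2" by (rule run_frame[OF 2])
    then have "frame (For x e c) s1 s2" by (auto simp: frame_def)
    then have "frame (For x e c) s s2" using 1 frame_trans by auto
    moreover have "I (Suc i) s2" using assms(2)[of i s1] 1 2 by (force simp: wp_def)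
    ultimately show "I (Suc i) (fst (s2, t1 + t2 + 1)) \<and> frame (For x e c) s (fst (s2, t1 + t2 + 1))"
      by simp
  qed (use assms(1) frame_refl in auto)
  then show ?thesis using assms(3) by (simp add: wp_def)
qed

lemma wp_mono: "wp c Q s \<Longrightarrow> (\<And>s'. frame c s s' \<Longrightarrow> Q s' \<Longrightarrow> Q' s') \<Longrightarrow> wp c Q' s"
  unfolding wp_def using run_frame by (metis prod.collapse)

text \<open>
  Arrays beyond the input: naturals 5 marks, 6 numbers of clients below, 7 representative leaf of a
  lowest vertex, 8 lowest vertex of a leaf, 9 inner vertices, 10 and 11 loop counters, 12 current
  vertex, 13 and 14 level and name of the lowest vertex on the current path, 15 waste; reals 1 bias,
  2 edge weights, 3 scratch, 4 the capped privacy parameter.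
\<close>

abbreviation "idx \<equiv> NLoad 10 (NConst 0)"
abbreviation "stp \<equiv> NLoad 11 (NConst 0)"
abbreviation "cur \<equiv> NLoad 12 (NConst 0)"
abbreviation "vertices \<equiv> NLoad 0 (NConst 0)"
abbreviation "depth_bound \<equiv> NLoad 0 (NConst 2)"
abbreviation "skip \<equiv> NStore 15 (NConst 0) (NConst 0)"
abbreviation "is_leaf \<equiv> NLess (NConst 0) (NLoad 2 idx)"
abbreviation "climb \<equiv> NStore 12 (NConst 0) (NLoad 1 cur)"
abbreviation "rone \<equiv> ROfNat (NConst 1)"
abbreviation "scratch \<equiv> RLoad 3 (NConst 0)"

text \<open>The cost analysis requires a parameter of at most 1, and lowering the parameter only
  strengthens privacy.\<close>

definition cap_eps :: com where
  "cap_eps = Cond (RLess (RLoad 0 (NConst 2)) rone)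
     (RStore 4 (NConst 0) (RLoad 0 (NConst 2))) (RStore 4 (NConst 0) rone)"

text \<open>One round more than \<open>find_low\<close>: counts are needed at the root as well,
  whereas the search for unmarked vertices stops below it because the root counts as marked.\<close>

definition count_path :: com where
  "count_path = For 11 (NAdd depth_bound (NConst 1))
     (Seq (NStore 6 cur (NAdd (NLoad 6 cur) (NLoad 3 idx)))
     (Seq (RStore 2 cur scratch)
     (Seq climb (RStore 3 (NConst 0) (RMul scratch (RLoad 0 (NConst 0)))))))"

definition count_all :: com where
  "count_all = For 10 vertices (Cond is_leaf
     (Seq (NStore 12 (NConst 0) idx) (Seq (RStore 3 (NConst 0) rone) count_path)) skip)"

definition set_bias :: "nat \<Rightarrow> com" where
  "set_bias M = For 10 vertices (Cond (RLess (RLoad 2 idx) (RLoad 0 (NConst 1)))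
     (Seq (RStore 3 (NConst 0)
       (RExp (RDiv (RLn (RDiv (RLoad 2 idx) (RLoad 0 (NConst 1)))) (ROfNat (NConst 2)))))
     (RStore 1 idx (RDiv rone (RAdd rone (RExp (RSub (ROfNat (NConst 0)) (RDiv
       (RSub (RMul (RMul (RLoad 4 (NConst 0)) scratch) (ROfNat (NLoad 6 idx))) (RDiv rone scratch))
       (ROfNat (NConst M)))))))))
     (RStore 1 idx rone))"

definition flip_marks :: com where
  "flip_marks = For 10 vertices (Flip 5 idx (RLoad 1 idx))"

definition find_low :: com where
  "find_low = For 11 depth_bound
     (Seq (Cond (NLess (NConst 0) (NLoad 5 cur)) skip
       (Seq (NStore 13 (NConst 0) (NAdd stp (NConst 1))) (NStore 14 (NConst 0) (NLoad 1 cur))))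
     climb)"

text \<open>The climb precedes the test, so round \<open>k\<close> treats the ancestor of level
  \<open>k + 1\<close>, as in \<open>inner\<close>.\<close>

definition mark_inner :: com where
  "mark_inner = For 11 depth_bound
     (Seq climb (Cond (NLess stp (NLoad 13 (NConst 0))) skip (NStore 9 cur (NConst 1))))"

definition find_all :: com where
  "find_all = For 10 vertices (Cond is_leaf
     (Seq (NStore 12 (NConst 0) idx) (Seq (NStore 13 (NConst 0) (NConst 0))
     (Seq (NStore 14 (NConst 0) idx) (Seq find_low
     (Seq (NStore 8 idx (NLoad 14 (NConst 0))) (Seq (NStore 7 (NLoad 14 (NConst 0)) idx)
     (Seq (NStore 12 (NConst 0) idx) mark_inner))))))) skip)"

definition emit :: com where
  "emit = For 10 vertices (Cond is_leaf
     (Cond (NLess (NConst 0) (NLoad 9 (NLoad 8 idx))) skip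
       (NStore 4 (NLoad 7 (NLoad 8 idx)) (NConst 1))) skip)"

definition program :: "nat \<Rightarrow> com" where
  "program M = Seq (Seq cap_eps (Seq count_all (set_bias M))) (Seq flip_marks (Seq find_all emit))"

lemma bounded_loops_program: "bounded_loops (program M)" "0 \<notin> nwrites (program M)"
  by (simp_all add: program_def cap_eps_def count_all_def count_path_def set_bias_def flip_marks_def
      find_all_def find_low_def mark_inner_def emit_def)

text \<open>Each round adds one independent coordinate to the product, which is the recursion of
  \<open>Pi_pmf\<close> over an inserted index.\<close>

lemma flip_marks_distribution:
  assumes "\<And>v. nats s 5 v = 0"
  shows "map_pmf (\<lambda>x v. nats (fst x) 5 v \<noteq> 0) (run flip_marks s) =
    Pi_pmf {..<nats s 0 0} False (\<lambda>v. bernoulli_pmf (reals s 1 v))"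
proof -
  let ?m = "\<lambda>x v. nats (fst x) 5 v \<noteq> 0"
  let ?b = "\<lambda>i s1. run (Flip 5 idx (RLoad 1 idx)) (nstore 10 0 i s1)"
  have "map_pmf ?m (iterate ?b k s) = Pi_pmf {..<k} False (\<lambda>v. bernoulli_pmf (reals s 1 v))" for k
  proof (induction k)
    case 0
    then show ?case using assms by simp
  next
    case (Suc k)
    \<comment> \<open>Flips write no reals, so the bias of coin \<open>k\<close> does not depend on
      the earlier coins.\<close>
    have keep: "reals (fst x) = reals s" if "x \<in> set_pmf (iterate ?b k s)" for x
    proof -
      have "\<forall>x\<in>set_pmf (iterate ?b k s). reals (fst x) = reals s"
        by (rule iterate_invariant[where J = "\<lambda>_ x. reals (fst x) = reals s"]) auto
      then show ?thesis using that by blast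
    qed
    have "map_pmf ?m (iterate ?b (Suc k) s) = bind_pmf (iterate ?b k s)
        (\<lambda>x. map_pmf (\<lambda>y. (?m x)(k := y)) (bernoulli_pmf (reals (fst x) 1 k)))"
      by (auto simp: map_bind_pmf map_pmf_comp split_def fun_eq_iff intro!: bind_pmf_cong map_pmf_cong)
    also have "\<dots> = bind_pmf (iterate ?b k s)
        (\<lambda>x. map_pmf (\<lambda>y. (?m x)(k := y)) (bernoulli_pmf (reals s 1 k)))"
      using keep by (intro bind_pmf_cong) auto
    also have "\<dots> = bind_pmf (map_pmf ?m (iterate ?b k s))
        (\<lambda>m. map_pmf (\<lambda>y. m(k := y)) (bernoulli_pmf (reals s 1 k)))"
      by (simp add: bind_map_pmf)
    also have "\<dots> = Pi_pmf (insert k {..<k}) False (\<lambda>v. bernoulli_pmf (reals s 1 v))"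
      unfolding Suc by (subst Pi_pmf_insert') (auto simp: map_pmf_def intro: bind_commute_pmf)
    finally show ?case by (simp add: lessThan_Suc)
  qed
  then show ?thesis by (simp add: flip_marks_def)
qed

section \<open>Correctness of the phases of the program\<close>

context hst
begin

definition env :: "(nat \<Rightarrow> nat) \<Rightarrow> real \<Rightarrow> real \<Rightarrow> memory \<Rightarrow> bool" where
  "env N f \<epsilon> s \<longleftrightarrow> nats s 0 0 = n \<and> nats s 0 2 = L \<and> (\<forall>v<n. nats s 1 v = par T v) \<and>
     (\<forall>v. nats s 2 v = of_bool (v \<in> leaves T)) \<and> (\<forall>v\<in>leaves T. nats s 3 v = N v) \<and>
     reals s 0 0 = lam \<and> reals s 0 1 = f \<and> reals s 0 2 = \<epsilon>"

lemma env_frame: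
  assumes "env N f \<epsilon> s" "frame c s s'" "{0, 1, 2, 3} \<inter> nwrites c = {}" "0 \<notin> rwrites c"
  shows "env N f \<epsilon> s'"
  using assms by (auto simp: env_def frame_def)

lemma env_nstore [simp]: "3 < a \<Longrightarrow> env N f \<epsilon> (nstore a i k s) = env N f \<epsilon> s"
  by (auto simp: env_def)

lemma env_rstore [simp]: "0 < a \<Longrightarrow> env N f \<epsilon> (rstore a i x s) = env N f \<epsilon> s"
  by (auto simp: env_def)

lemma wp_count_path:
  assumes env: "env N f \<epsilon> s" and u: "nats s 10 0 = u" "u \<in> leaves T"
    and init: "nats s 12 0 = u" "reals s 3 0 = 1"
  shows "wp count_path (\<lambda>s'.
      (\<forall>v. nats s' 6 v = nats s 6 v + (if \<exists>j\<le>L. anc T j u = v then N u else 0)) \<and>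
      (\<forall>v. reals s' 2 v = (if \<exists>j\<le>L. anc T j u = v then lam ^ level T v else reals s 2 v))) s"
  unfolding count_path_def
proof (rule wp_For[where I = "\<lambda>k s'. nats s' 12 0 = anc T k u \<and> reals s' 3 0 = lam ^ k \<and>
      (\<forall>v. nats s' 6 v = nats s 6 v + (if \<exists>j<k. anc T j u = v then N u else 0)) \<and>
      (\<forall>v. reals s' 2 v = (if \<exists>j<k. anc T j u = v then lam ^ level T v else reals s 2 v))"],
      goal_cases)
  case 1
  then show ?case using init by simp
next
  case (2 k s')
  have k: "k \<le> L" using 2(1) env by (simp add: env_def)
  have e: "env N f \<epsilon> s'" by (rule env_frame[OF env 2(3)]) auto
  have u': "nats s' 10 0 = u" using 2(3) u by (simp add: frame_def)
  \<comment> \<open>Distinctness of the ancestors up to level \<open>L\<close> ensures that no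
    vertex, in particular not the root, is counted twice for one leaf.\<close>
  have new: "anc T j u \<noteq> anc T k u" if "j < k" for j
    using anc_eq_level[OF u(2) u(2) _ k, of j] that k by auto
  have ex: "(\<exists>j<Suc k. anc T j u = v) \<longleftrightarrow> (\<exists>j<k. anc T j u = v) \<or> v = anc T k u" for v
    by (auto simp: less_Suc_eq)
  show ?case
    using 2(2) e u' new u k anc_lt[OF leaf_lt[OF u(2)], of k] level_anc[OF u(2) k]
    by (auto simp: env_def ex anc_Suc mult.commute)
next
  case (3 s')
  then show ?case using env by (simp add: env_def less_Suc_eq_le)
qed

lemma wp_count_all:
  assumes env: "env N f \<epsilon> s" and init: "\<And>v. nats s 6 v = 0" "\<And>v. reals s 2 v = 0"
  shows "wp count_all (\<lambda>s'. \<forall>v. nats s' 6 v = cnt T N n v \<and> reals s' 2 v = weight lam T n v) s"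
  unfolding count_all_def
proof (rule wp_For[where I = "\<lambda>i s'. \<forall>v. nats s' 6 v = cnt T N i v \<and> reals s' 2 v = weight lam T i v"],
      goal_cases)
  case 1
  then show ?case using init by simp
next
  case (2 i s')
  have e: "env N f \<epsilon> s'" by (rule env_frame[OF env 2(3)]) (auto simp: count_path_def)
  show ?case
  proof (cases "i \<in> leaves T")
    case True
    have "wp count_path (\<lambda>s''. \<forall>v. nats s'' 6 v = cnt T N (Suc i) v \<and> reals s'' 2 v = weight lam T (Suc i) v)
        (rstore 3 0 1 (nstore 12 0 i (nstore 10 0 i s')))"
      by (rule wp_mono[OF wp_count_path[where N = N and f = f and \<epsilon> = \<epsilon> and u = i]])
        (use e True 2(2) in auto)
    then show ?thesis using e True by (simp add: env_def)
  next
    case False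
    then show ?thesis using e 2(2) by (simp add: env_def)
  qed
next
  case (3 s')
  then show ?case using env by (simp add: env_def)
qed

lemma wp_set_bias:
  assumes env: "env N f \<epsilon> s"
  shows "wp (set_bias M) (\<lambda>s'. \<forall>v<n. reals s' 1 v = bias M f (reals s 4 0) (reals s 2 v) (nats s 6 v)) s"
  unfolding set_bias_def
proof (rule wp_For[where I = "\<lambda>i s'. \<forall>v<i. reals s' 1 v = bias M f (reals s 4 0) (reals s 2 v) (nats s 6 v)"],
      goal_cases)
  case 1
  then show ?case by simp
next
  case (2 i s')
  have e: "env N f \<epsilon> s'" by (rule env_frame[OF env 2(3)]) auto
  have "reals s' 4 0 = reals s 4 0" "reals s' 2 i = reals s 2 i" "nats s' 6 i = nats s 6 i"
    using 2(3) by (auto simp: frame_def)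
  then show ?case
    using 2(2) e by (auto simp: env_def less_Suc_eq bias_def root_ratio_def)
next
  case (3 s')
  then show ?case using env by (simp add: env_def)
qed

lemma wp_find_low:
  assumes env: "env N f \<epsilon> s" and m: "\<And>v. m v \<longleftrightarrow> nats s 5 v \<noteq> 0" and u: "u \<in> leaves T"
    and init: "nats s 12 0 = u" "nats s 13 0 = 0" "nats s 14 0 = u"
  shows "wp find_low (\<lambda>s'. nats s' 13 0 = low_level T m u \<and> nats s' 14 0 = low T m u) s"
  unfolding find_low_def
proof (rule wp_For[where I = "\<lambda>k s'. nats s' 12 0 = anc T k u \<and> nats s' 13 0 = lowk T m u k \<and>
      nats s' 14 0 = anc T (lowk T m u k) u"], goal_cases)
  case 1
  then show ?case using init by simp
next
  case (2 k s')
  have e: "env N f \<epsilon> s'" by (rule env_frame[OF env 2(3)]) auto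
  have "nats s' 5 v = nats s 5 v" for v using 2(3) by (simp add: frame_def)
  then show ?case
    using 2(2) e m anc_lt[OF leaf_lt[OF u], of k] by (auto simp: env_def anc_Suc)
next
  case (3 s')
  then show ?case using env by (simp add: env_def low_level_def low_def)
qed

lemma wp_mark_inner:
  assumes env: "env N f \<epsilon> s" and u: "u \<in> leaves T" and init: "nats s 12 0 = u" "nats s 13 0 = l"
  shows "wp mark_inner (\<lambda>s'. \<forall>v. nats s' 9 v \<noteq> 0 \<longleftrightarrow>
    nats s 9 v \<noteq> 0 \<or> (\<exists>k. l \<le> k \<and> k < L \<and> anc T (Suc k) u = v)) s"
  unfolding mark_inner_def
proof (rule wp_For[where I = "\<lambda>i s'. nats s' 12 0 = anc T i u \<and> (\<forall>v. nats s' 9 v \<noteq> 0 \<longleftrightarrow>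
    nats s 9 v \<noteq> 0 \<or> (\<exists>k. l \<le> k \<and> k < i \<and> anc T (Suc k) u = v))"], goal_cases)
  case 1
  then show ?case using init by simp
next
  case (2 i s')
  have e: "env N f \<epsilon> s'" by (rule env_frame[OF env 2(3)]) auto
  have l: "nats s' 13 0 = l" using 2(3) init by (simp add: frame_def)
  have ex: "(\<exists>k\<ge>l. k < Suc i \<and> anc T (Suc k) u = v) \<longleftrightarrow>
      (\<exists>k\<ge>l. k < i \<and> anc T (Suc k) u = v) \<or> l \<le> i \<and> v = anc T (Suc i) u" for v
    by (auto simp: less_Suc_eq)
  show ?case
    using 2(2) e l anc_lt[OF leaf_lt[OF u], of i] unfolding ex
    by (auto simp: env_def anc_Suc)
next
  case (3 s')
  then show ?case using env by (simp add: env_def)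
qed

lemma wp_find_all:
  assumes env: "env N f \<epsilon> s" and m: "\<And>v. m v \<longleftrightarrow> nats s 5 v \<noteq> 0"
    and init: "\<And>v. nats s 7 v = 0" "\<And>v. nats s 9 v = 0"
  shows "wp find_all (\<lambda>s'. (\<forall>u\<in>leaves T. nats s' 8 u = low T m u) \<and> (\<forall>v. nats s' 7 v = rep T m n v) \<and>
    (\<forall>v. nats s' 9 v \<noteq> 0 \<longleftrightarrow> inner T m v)) s"
  unfolding find_all_def
proof (rule wp_For[where I = "\<lambda>i s'. (\<forall>u\<in>leaves T. u < i \<longrightarrow> nats s' 8 u = low T m u) \<and>
    (\<forall>v. nats s' 7 v = rep T m i v) \<and>
    (\<forall>v. nats s' 9 v \<noteq> 0 \<longleftrightarrow> (\<exists>u\<in>leaves T. u < i \<and>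
      (\<exists>k. low_level T m u \<le> k \<and> k < L \<and> anc T (Suc k) u = v)))"], goal_cases)
  case 1
  then show ?case using init by simp
next
  case (2 i s')
  let ?I = "\<lambda>s'. (\<forall>u\<in>leaves T. u < Suc i \<longrightarrow> nats s' 8 u = low T m u) \<and>
    (\<forall>v. nats s' 7 v = rep T m (Suc i) v) \<and>
    (\<forall>v. nats s' 9 v \<noteq> 0 \<longleftrightarrow> (\<exists>u\<in>leaves T. u < Suc i \<and>
      (\<exists>k. low_level T m u \<le> k \<and> k < L \<and> anc T (Suc k) u = v)))"
  have e: "env N f \<epsilon> s'" by (rule env_frame[OF env 2(3)]) (auto simp: find_low_def mark_inner_def)
  have m': "m v \<longleftrightarrow> nats s' 5 v \<noteq> 0" for v
    using 2(3) m by (simp add: frame_def find_low_def mark_inner_def)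
  have leaf: "nats s' 2 i = of_bool (i \<in> leaves T)" using e by (simp add: env_def)
  show ?case
  proof (cases "i \<in> leaves T")
    case True
    let ?s1 = "nstore 14 0 i (nstore 13 0 0 (nstore 12 0 i (nstore 10 0 i s')))"
    have "wp find_low (\<lambda>s2. wp mark_inner ?I (nstore 12 0 (nats s2 10 0)
        (nstore 7 (nats s2 14 0) (nats s2 10 0) (nstore 8 (nats s2 10 0) (nats s2 14 0) s2)))) ?s1"
    proof (rule wp_mono[OF wp_find_low[where m = m and u = i]], goal_cases)
      case (7 s2)
      have fr: "nats s2 10 0 = i" "nats s2 8 v = nats s' 8 v" "nats s2 7 v = nats s' 7 v"
          "nats s2 9 v = nats s' 9 v" for v
        using 7(1) by (simp_all add: frame_def find_low_def)
      have e2: "env N f \<epsilon> s2" by (rule env_frame[OF _ 7(1)]) (use e in \<open>auto simp: find_low_def\<close>)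
      let ?s3 = "nstore 12 0 i (nstore 7 (low T m i) i (nstore 8 i (low T m i) s2))"
      have "wp mark_inner ?I ?s3"
      proof (rule wp_mono[OF wp_mark_inner[where N = N and f = f and \<epsilon> = \<epsilon> and u = i and l = "low_level T m i"]],
          goal_cases)
        case (5 s4)
        have "nats s4 8 v = nats ?s3 8 v" "nats s4 7 v = nats ?s3 7 v" for v
          using 5(1) by (simp_all add: frame_def mark_inner_def)
        then show ?case
          using 5(2) 2(2) True fr by (auto simp: less_Suc_eq)
      qed (use e2 True 7 in auto)
      then show ?case using fr 7 by simp
    qed (use e m' True in auto)
    then show ?thesis using leaf True by simp
  next
    case False
    then show ?thesis using leaf 2(2) by (auto simp: less_Suc_eq)
  qed
next
  case (3 s')
  then show ?case using env leaf_lt by (auto simp: env_def inner_def)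
qed

lemma wp_emit:
  assumes env: "env N f \<epsilon> s" and low: "\<And>u. u \<in> leaves T \<Longrightarrow> nats s 8 u = low T m u"
    and rep: "\<And>v. nats s 7 v = rep T m n v" and inner: "\<And>v. nats s 9 v \<noteq> 0 \<longleftrightarrow> inner T m v"
    and init: "\<And>v. nats s 4 v = 0"
  shows "wp emit (\<lambda>s'. output_set T s' = out_set T m) s"
  unfolding emit_def
proof (rule wp_For[where I = "\<lambda>i s'. \<forall>v. nats s' 4 v \<noteq> 0 \<longleftrightarrow>
    (\<exists>u\<in>leaves T. u < i \<and> \<not> inner T m (low T m u) \<and> v = rep T m n (low T m u))"], goal_cases)
  case 1
  then show ?case using init by simp
next
  case (2 i s')
  have e: "env N f \<epsilon> s'" by (rule env_frame[OF env 2(3)]) auto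
  have "nats s' 8 v = nats s 8 v" "nats s' 7 v = nats s 7 v" "nats s' 9 v = nats s 9 v" for v
    using 2(3) by (auto simp: frame_def)
  then show ?case
    using 2(2) e low rep inner by (auto simp: env_def less_Suc_eq)
next
  case (3 s')
  then have "{v. nats s' 4 v \<noteq> 0} = out_set T m"
    using env leaf_lt by (auto simp: env_def out_set_def)
  then show ?case using out_set_leaves[of m] by (auto simp: output_set_def)
qed

end

section \<open>The output distribution of the program\<close>

lemma map_run_Seq:
  "map_pmf (\<lambda>x. g (fst x)) (run (Seq c c') s) =
     bind_pmf (run c s) (\<lambda>x. map_pmf (\<lambda>x. g (fst x)) (run c' (fst x)))"
  by (simp add: map_bind_pmf map_pmf_comp split_def)

lemma map_run_const:
  assumes "wp c (\<lambda>s'. g s' = a) s"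
  shows "map_pmf (\<lambda>x. g (fst x)) (run c s) = return_pmf a"
proof -
  have "map_pmf (\<lambda>x. g (fst x)) (run c s) = map_pmf (\<lambda>x. a) (run c s)"
    using assms by (intro map_pmf_cong) (auto simp: wp_def)
  then show ?thesis by simp
qed

context hst
begin

lemma env_input: "env N f \<epsilon> (input_memory lam \<epsilon> T f N)"
  by (simp add: env_def input_memory_def par_def)

lemma wp_prepare:
  assumes env: "env N f \<epsilon> s" and init: "\<And>v. nats s 6 v = 0" "\<And>v. reals s 2 v = 0"
  shows "wp (Seq cap_eps (Seq count_all (set_bias M)))
    (\<lambda>s'. \<forall>v<n. reals s' 1 v = bias M f (min \<epsilon> 1) (weight lam T n v) (cnt T N n v)) s"
proof -
  let ?Q = "\<lambda>s'. \<forall>v<n. reals s' 1 v = bias M f (min \<epsilon> 1) (weight lam T n v) (cnt T N n v)"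
  have "wp cap_eps (\<lambda>s'. reals s' 4 0 = min \<epsilon> 1) s"
    using env by (simp add: cap_eps_def env_def)
  then have "wp cap_eps (wp (Seq count_all (set_bias M)) ?Q) s"
  proof (rule wp_mono)
    fix s1 assume fr1: "frame cap_eps s s1" and eps: "reals s1 4 0 = min \<epsilon> 1"
    have env1: "env N f \<epsilon> s1" by (rule env_frame[OF env fr1]) (auto simp: cap_eps_def)
    have init1: "nats s1 6 v = 0" "reals s1 2 v = 0" for v
      using fr1 init by (auto simp: frame_def cap_eps_def)
    have "wp count_all (wp (set_bias M) ?Q) s1"
    proof (rule wp_mono[OF wp_count_all[OF env1 init1]])
      fix s2 assume fr2: "frame count_all s1 s2"
        and cnt: "\<forall>v. nats s2 6 v = cnt T N n v \<and> reals s2 2 v = weight lam T n v"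
      have env2: "env N f \<epsilon> s2"
        by (rule env_frame[OF env1 fr2]) (auto simp: count_all_def count_path_def)
      have "reals s2 4 0 = min \<epsilon> 1"
        using fr2 eps by (simp add: frame_def count_all_def count_path_def)
      then show "wp (set_bias M) ?Q s2"
        using cnt by (intro wp_mono[OF wp_set_bias[OF env2]]) simp
    qed
    then show "wp (Seq count_all (set_bias M)) ?Q s1" by simp
  qed
  then show ?thesis by simp
qed

lemma wp_select:
  assumes env: "env N f \<epsilon> s" and init: "\<And>v. nats s 4 v = 0" "\<And>v. nats s 7 v = 0" "\<And>v. nats s 9 v = 0"
  shows "wp (Seq find_all emit) (\<lambda>s'. output_set T s' = out_set T (\<lambda>v. nats s 5 v \<noteq> 0)) s"
  unfolding wp_Seq
proof (rule wp_mono[OF wp_find_all[OF env refl init(2,3)]])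
  fix s1 assume fr: "frame find_all s s1"
    and found: "(\<forall>u\<in>leaves T. nats s1 8 u = low T (\<lambda>v. nats s 5 v \<noteq> 0) u) \<and>
      (\<forall>v. nats s1 7 v = rep T (\<lambda>v. nats s 5 v \<noteq> 0) n v) \<and>
      (\<forall>v. nats s1 9 v \<noteq> 0 \<longleftrightarrow> inner T (\<lambda>v. nats s 5 v \<noteq> 0) v)"
  have env1: "env N f \<epsilon> s1"
    by (rule env_frame[OF env fr]) (auto simp: find_all_def find_low_def mark_inner_def)
  have "nats s1 4 v = 0" for v
    using fr init(1) by (simp add: frame_def find_all_def find_low_def mark_inner_def)
  then show "wp emit (\<lambda>s'. output_set T s' = out_set T (\<lambda>v. nats s 5 v \<noteq> 0)) s1"
    using found by (intro wp_emit[OF env1]) auto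
qed

text \<open>The preparation has a determined effect on the biases, and the selection is a function
  of the marks. Hence the output is an image of the product of coins, and
  \<open>marks_pmf_private\<close> and \<open>expected_cost_le\<close> apply.\<close>

lemma ufl_algorithm_program:
  "ufl_algorithm (program M) lam \<epsilon> T f N = map_pmf (out_set T) (marks_pmf M lam T f (min \<epsilon> 1) N)"
proof -
  let ?out = "\<lambda>x. output_set T (fst x)"
  let ?s0 = "input_memory lam \<epsilon> T f N"
  let ?c1 = "Seq cap_eps (Seq count_all (set_bias M))"
  let ?D = "map_pmf (out_set T) (marks_pmf M lam T f (min \<epsilon> 1) N)"
  have const: "map_pmf ?out (run (Seq flip_marks (Seq find_all emit)) s1) = ?D"
    if s1: "(s1, t) \<in> set_pmf (run ?c1 ?s0)" for s1 t
  proof -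
    have fr1: "frame ?c1 ?s0 s1" by (rule run_frame[OF s1])
    have env1: "env N f \<epsilon> s1"
      by (rule env_frame[OF env_input fr1])
        (auto simp: cap_eps_def count_all_def count_path_def set_bias_def)
    have zero: "nats s1 4 v = 0" "nats s1 5 v = 0" "nats s1 7 v = 0" "nats s1 9 v = 0" for v
      using fr1
      by (simp_all add: frame_def cap_eps_def count_all_def count_path_def set_bias_def input_memory_def)
    have "wp ?c1 (\<lambda>s'. \<forall>v<n. reals s' 1 v = bias M f (min \<epsilon> 1) (weight lam T n v) (cnt T N n v)) ?s0"
      by (rule wp_prepare[OF env_input]) (simp_all add: input_memory_def)
    then have bias: "\<forall>v<n. reals s1 1 v = bias M f (min \<epsilon> 1) (weight lam T n v) (cnt T N n v)"
      using s1 unfolding wp_def by (metis fst_conv)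
    have "map_pmf ?out (run (Seq flip_marks (Seq find_all emit)) s1) =
        bind_pmf (run flip_marks s1) (\<lambda>x. return_pmf (out_set T (\<lambda>v. nats (fst x) 5 v \<noteq> 0)))"
      unfolding map_run_Seq[of "output_set T" flip_marks]
    proof (rule bind_pmf_cong[OF refl])
      fix x assume "x \<in> set_pmf (run flip_marks s1)"
      then have fr2: "frame flip_marks s1 (fst x)" using run_frame[of "fst x" "snd x"] by simp
      have env2: "env N f \<epsilon> (fst x)" by (rule env_frame[OF env1 fr2]) (auto simp: flip_marks_def)
      show "map_pmf ?out (run (Seq find_all emit) (fst x)) =
          return_pmf (out_set T (\<lambda>v. nats (fst x) 5 v \<noteq> 0))"
        by (rule map_run_const, rule wp_select[OF env2])
          (use fr2 zero in \<open>simp_all add: frame_def flip_marks_def\<close>)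
    qed
    also have "\<dots> = map_pmf (out_set T) (map_pmf (\<lambda>x v. nats (fst x) 5 v \<noteq> 0) (run flip_marks s1))"
      by (simp add: map_pmf_comp map_pmf_def[symmetric])
    also have "\<dots> = map_pmf (out_set T) (Pi_pmf {..<n} False (\<lambda>v. bernoulli_pmf (reals s1 1 v)))"
      using flip_marks_distribution[OF zero(2)] env1 by (simp add: env_def)
    also have "Pi_pmf {..<n} False (\<lambda>v. bernoulli_pmf (reals s1 1 v)) = marks_pmf M lam T f (min \<epsilon> 1) N"
      unfolding marks_pmf_def by (rule Pi_pmf_cong) (use bias in auto)
    finally show ?thesis .
  qed
  have "ufl_algorithm (program M) lam \<epsilon> T f N = map_pmf ?out (run (program M) ?s0)"
    by (simp add: ufl_algorithm_def split_def)
  also have "\<dots> = bind_pmf (run ?c1 ?s0) (\<lambda>x. ?D)"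
    unfolding program_def map_run_Seq[of "output_set T" ?c1]
    by (rule bind_pmf_cong[OF refl]) (use const in \<open>metis prod.collapse\<close>)
  finally show ?thesis by simp
qed

end

text \<open>For \<open>y = 0\<close> the assumption forces \<open>x = 0\<close>, and 0 / 0 = 0 in
  \<open>ennreal\<close>.\<close>

lemma ennreal_divide_le:
  fixes x y c :: ennreal
  assumes "x \<le> c * y" shows "x / y \<le> c"
  using assms by (cases "y = 0") (auto intro!: divide_le_posI_ennreal simp: zero_less_iff_neq_zero mult.commute)

theorem theorem2:
  shows "\<exists>lam0>1. \<forall>lam. 1 < lam \<and> lam < lam0 \<longrightarrow>
    (\<exists>(c :: com) (C :: real). 0 < C \<and> efficient c lam \<and>
      (\<forall>\<epsilon>>0.
        (\<forall>T V d f. hst_instance lam T V d f \<longrightarrow>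
           differentially_private \<epsilon> V (ufl_algorithm c lam \<epsilon> T f)) \<and>
        approx_ratio lam (ufl_algorithm c lam \<epsilon>) \<le> ennreal (C * max 1 (1 / \<epsilon>))))"
proof (intro exI[of _ "2 :: real"] conjI allI impI)
  fix lam :: real assume "1 < lam \<and> lam < 2"
  then have lam: "1 < lam" by simp
  \<comment> \<open>A natural number, because programs contain no other constants. It depends on
    \<open>lam\<close> alone, so one program and one \<open>C\<close> serve all \<epsilon>.\<close>
  obtain M :: nat where M: "sqrt lam / (sqrt lam - 1) \<le> real M"
    using real_arch_simple by blast
  define C where "C = 2 + 216 * real M ^ 4 + 2 * lam / (lam - 1) * (2 + 2 * real M ^ 2)"
  have C: "0 < C" using lam by (auto simp: C_def intro!: add_pos_nonneg)
  have inst: "hst T lam" "V = leaves T" "leaves T \<noteq> {}" "0 \<le> f"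
      "\<And>N. hst_ufl T lam f d" if "hst_instance lam T V d f" for T V d f
    using that lam
    by (auto simp: hst_instance_def hst_metric_def ufl_instance_def hst_def hst_ufl_def hst_ufl_axioms_def)
  have "efficient (program M) lam"
    unfolding efficient_def
  proof (intro exI[of _ "time_poly (program M)"] allI impI)
    fix \<epsilon> :: real and T V d f N assume "hst_instance lam T V d f"
    note i = inst[OF this]
    obtain u where "u \<in> leaves T" using i by blast
    then have "height T < vnum T" by (rule hst.height_lt[OF i(1)])
    then have "t \<le> poly (time_poly (program M)) (vnum T)"
      if "(s, t) \<in> set_pmf (run (program M) (input_memory lam \<epsilon> T f N))" for s t
      using run_time[OF bounded_loops_program _ _ that] by (simp add: input_memory_def)
    then show "\<forall>(s, t)\<in>set_pmf (run (program M) (input_memory lam \<epsilon> T f N)). t \<le> poly (time_poly (program M)) (vnum T)"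
      by blast
  qed
  moreover have "differentially_private \<epsilon> V (ufl_algorithm (program M) lam \<epsilon> T f)"
    if \<epsilon>: "0 < \<epsilon>" and i: "hst_instance lam T V d f" for \<epsilon> T V d f
  proof -
    note i = inst[OF i]
    have "differentially_private (min \<epsilon> 1) V (ufl_algorithm (program M) lam \<epsilon> T f)"
      unfolding hst.ufl_algorithm_program[OF i(1)] i(2)
      by (rule hst.marks_pmf_private[OF i(1) _ M]) (use \<epsilon> in simp)
    moreover have "exp (min \<epsilon> 1) * measure_pmf.prob p E \<le> exp \<epsilon> * measure_pmf.prob p E" for p and E :: "nat set set"
      by (intro mult_right_mono) auto
    ultimately show ?thesis
      unfolding differentially_private_def by (meson order_trans)
  qed
  moreover have "approx_ratio lam (ufl_algorithm (program M) lam \<epsilon>) \<le> ennreal (C * max 1 (1 / \<epsilon>))"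
    if \<epsilon>: "0 < \<epsilon>" for \<epsilon>
    unfolding approx_ratio_def
  proof (rule SUP_least, clarify)
    fix T V d f and N :: "nat \<Rightarrow> nat" assume "hst_instance lam T V d f"
    note i = inst[OF this]
    \<comment> \<open>The cap on \<epsilon> is the source of the maximum in the approximation
      ratio.\<close>
    have "max 1 (1 / \<epsilon>) = 1 / min \<epsilon> 1" using \<epsilon> by (auto simp: min_def max_def field_simps)
    then have "C * max 1 (1 / \<epsilon>) = C / min \<epsilon> 1" by simp
    then show "(\<integral>\<^sup>+ R. superset_cost V d f N R \<partial>measure_pmf (ufl_algorithm (program M) lam \<epsilon> T f N)) /
        ufl_opt V d f N \<le> ennreal (C * max 1 (1 / \<epsilon>))"
      unfolding hst.ufl_algorithm_program[OF i(1)] i(2) nn_integral_map_pmf C_def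
      using hst_ufl.expected_cost_le[OF i(5) _ _ M i(3), of "min \<epsilon> 1" N] \<epsilon>
      by (intro ennreal_divide_le) simp
  qed
  ultimately show "\<exists>(c :: com) (C :: real). 0 < C \<and> efficient c lam \<and>
      (\<forall>\<epsilon>>0.
        (\<forall>T V d f. hst_instance lam T V d f \<longrightarrow>
           differentially_private \<epsilon> V (ufl_algorithm c lam \<epsilon> T f)) \<and>
        approx_ratio lam (ufl_algorithm c lam \<epsilon>) \<le> ennreal (C * max 1 (1 / \<epsilon>)))"
    using C by blast
qed simp

end
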